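(* Let $T:\mathbb R\to\mathbb R$ be a surjective Markov map satisfying (A1)-(A4) (see context). Then the conservative-invariant part $\mathcal I_{\mathcal C}$ is made up (mod $m$) of at most countably many ergodic components of $T$, denoted $E_\alpha$. For each $\alpha$, the periods of all Markov intervals $I_j\subseteq E_\alpha$ are the same; denote the common value by $d_\alpha$. Moreover, $E_\alpha$ splits into $d_\alpha$ exact components of $T^{d_\alpha}$, denoted $E_{\alpha,i}$ with $0\le i\le d_\alpha-1$; each $E_{\alpha,i}$ belongs to $\mathscr M$; and $T E_{\alpha,i}=E_{\alpha,i+1}$ for $i\in\{0,1,\dots,d_\alpha-2\}$, and $T E_{\alpha,d_\alpha-1}=E_{\alpha,0}$.
   Context: Conventions: $m$ is Lebesgue measure on $\mathbb R$; $\mathbb N=\{0,1,2,\dots\}$, $\mathbb Z^+=\{1,2,\dots\}$; all equalities and inclusions of Borel sets are modulo $m$-null sets. Setting: $(a_j)_{j\in\mathbb Z}$ are reals with $\lim_{j\to\pm\infty}a_j=\pm\infty$, and $I_j:=[a_j,a_{j+1}]$ are the Markov intervals (regarded as a partition of $\mathbb R$, endpoints being ignored). $\mathscr M$ is the $\sigma$-algebra generated by the $I_j$. $T:\mathbb R\to\mathbb R$ is a surjective Markov map (values at the points $a_j$ are irrelevant; surjectivity means that each $I_k$ is contained in $TI_j$ for some $j$), with: (A1) there is $\theta>0$ with $0<a_{j+1}-a_j\le\theta$ for all $j$; (A2) $T|_{(a_j,a_{j+1})}$ has a unique extension $\tau_j:I_j\to J_j$ which is twice differentiable and bijective onto $J_j=\bigsqcup_{k=k_{1j}}^{k_{2j}}I_k$,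 for some integers $k_{1j}\le k_{2j}$; (A3) there is $\lambda>1$ with $|\tau_j'|\ge\lambda$ for all $j$; (A4) there is $\eta>0$ with $|\tau_j''/(\tau_j')^2|\le\eta$ for all $j$. Period of $I_j$: the greatest common divisor of $\{n\in\mathbb Z^+ : T^nI_j\supseteq I_j\}$ (set to $0$ if this set is empty). Conservative/dissipative parts: a Borel set $W$ is wandering if the sets $T^{-n}W$, $n\in\mathbb N$, are pairwise disjoint (mod $m$); $\mathcal D$ is the measurable union of all wandering sets and $\mathcal C:=\mathbb R\setminus\mathcal D$. A set $A$ is $T$-invariant if $T^{-1}A=A$. The invariant hull of $A$ is $\mathcal I(A):=\bigcup_{k\in\mathbb Z^+}\bigcup_{n\in\mathbb N}T^{-k}T^nA$, the smallest $T$-invariant set containing $A$. Put $\mathcal I_{\mathcal C\mathcal D}:=\mathcal I(\mathcal C)\cap\mathcal I(\mathcal D)$ and $\mathcal I_{\mathcal C}:=\mathcal I(\mathcal C)\setminus\mathcal I_{\mathcal C\mathcal D}$. For a map $S$ (here $T$ or a power of $T$), an ergodic component of $S$ is a set $A$ with $m(A)>0$ that is $S$-invariant and has no $S$-invariant subset of strictly smaller positive measure (i.e. every $S$-invariant subset is null or equals $A$ mod $m$). An exact component of $S$ is an ergodic component $A$ such that $S|_A$ is exact, i.e. every set in $\bigcap_{n\ge0}(S|_A)^{-n}\mathscr B_A$ ($\mathscr B_A$ the Borel subsets of $A$) is null or equal to $A$ mod $m$. *)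

theory Defs
  imports "HOL-Analysis.Analysis"
begin

definition eq_mod :: "real set \<Rightarrow> real set \<Rightarrow> bool"  (infix "=\<^sub>m" 50)
  where "A =\<^sub>m B \<longleftrightarrow> (AE x in lborel. x \<in> A \<longleftrightarrow> x \<in> B)"

definition subset_mod :: "real set \<Rightarrow> real set \<Rightarrow> bool"  (infix "\<subseteq>\<^sub>m" 50)
  where "A \<subseteq>\<^sub>m B \<longleftrightarrow> (AE x in lborel. x \<in> A \<longrightarrow> x \<in> B)"

text \<open>
  The measurable union of a family of Borel sets is its least Borel upper bound for inclusion
  modulo null sets. It is unique only modulo null sets, so some version of it is chosen; it
  exists by the lemma below.
\<close>

definition is_measurable_union :: "real set set \<Rightarrow> real set \<Rightarrow> bool"
  where "is_measurable_union \<W> U \<longleftrightarrow>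
    U \<in> sets borel \<and> (\<forall>W\<in>\<W>. W \<subseteq>\<^sub>m U) \<and>
    (\<forall>V\<in>sets borel. (\<forall>W\<in>\<W>. W \<subseteq>\<^sub>m V) \<longrightarrow> U \<subseteq>\<^sub>m V)"

definition measurable_union :: "real set set \<Rightarrow> real set"
  where "measurable_union \<W> = (SOME U. is_measurable_union \<W> U)"

lemma ex_is_measurable_union:
  assumes "\<W> \<subseteq> sets borel"
  shows "\<exists>U. is_measurable_union \<W> U"
proof -
  obtain h :: "real \<Rightarrow> ennreal" where h: "h \<in> borel_measurable lborel"
    "integral\<^sup>N lborel h \<noteq> \<infinity>" "\<And>x. 0 < h x \<and> h x < \<infinity>"
    using sigma_finite_measure.Ex_finite_integrable_function[OF sigma_finite_lborel] by auto
  define N where "N = density lborel h"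
  have sets_N [measurable_cong]: "sets N = sets borel"
    by (simp add: N_def)
  have "emeasure N (space N) = integral\<^sup>N lborel h"
    using h(1) by (simp add: N_def emeasure_density)
  then interpret N: finite_measure N
    using h(2) by (intro finite_measureI) auto
  have AE_N: "(AE x in N. P x) \<longleftrightarrow> (AE x in lborel. P x)" for P
    using h(3) unfolding N_def AE_density[OF h(1)] by simp
  define \<K> where "\<K> = {K. countable K \<and> K \<subseteq> \<W>}"
  have "\<K> \<noteq> {}"
    unfolding \<K>_def by blast
  from ennreal_SUP_countable_SUP[OF this, of "\<lambda>K. emeasure N (\<Union>K)"]
  obtain f :: "nat \<Rightarrow> ennreal" where f: "range f \<subseteq> (\<lambda>K. emeasure N (\<Union>K)) ` \<K>"
    "(SUP K\<in>\<K>. emeasure N (\<Union>K)) = Sup (range f)"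
    by auto
  from f(1) have "\<forall>n. \<exists>K\<in>\<K>. f n = emeasure N (\<Union>K)"
    by blast
  then obtain g where g: "\<And>n. g n \<in> \<K>" "\<And>n. f n = emeasure N (\<Union>(g n))"
    by metis
  define K where "K = (\<Union>n. g n)"
  have K: "K \<in> \<K>"
    using g(1) unfolding K_def \<K>_def by blast
  have borel_K: "\<Union>L \<in> sets borel" if "L \<in> \<K>" for L
    using that assms unfolding \<K>_def by (intro sets.countable_Union) auto
  have max: "emeasure N (\<Union>L) \<le> emeasure N (\<Union>K)" if "L \<in> \<K>" for L
  proof -
    have "emeasure N (\<Union>L) \<le> Sup (range f)"
      using that f(2) by (metis SUP_upper)
    also have "\<dots> \<le> emeasure N (\<Union>K)"
    proof (rule SUP_least)
      fix n show "f n \<le> emeasure N (\<Union>K)"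
        unfolding g(2) using borel_K[OF K] by (intro emeasure_mono) (auto simp: K_def sets_N)
    qed
    finally show ?thesis .
  qed
  have "W \<subseteq>\<^sub>m \<Union>K" if "W \<in> \<W>" for W
  proof -
    have W: "W \<in> sets N" and KN: "\<Union>K \<in> sets N"
      using that assms borel_K[OF K] by (auto simp: sets_N)
    have "insert W K \<in> \<K>"
      using K that by (auto simp: \<K>_def)
    from max[OF this] have le: "emeasure N (W \<union> \<Union>K) \<le> emeasure N (\<Union>K)"
      by simp
    have "measure N (\<Union>K) + measure N (W - \<Union>K) = measure N (W \<union> \<Union>K)"
      using N.finite_measure_Union[of "\<Union>K" "W - \<Union>K"] W KN
      by (simp add: Un_commute)
    moreover have "measure N (W \<union> \<Union>K) \<le> measure N (\<Union>K)"
      using le by (simp add: N.emeasure_eq_measure)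
    ultimately have "measure N (W - \<Union>K) = 0"
      by (smt (verit) measure_nonneg)
    then have "W - \<Union>K \<in> null_sets N"
      using W KN by (auto simp: null_sets_def N.emeasure_eq_measure)
    then have "AE x in N. x \<notin> W - \<Union>K"
      by (rule AE_not_in)
    then show ?thesis
      unfolding subset_mod_def by (simp add: AE_N)
  qed
  moreover have "\<Union>K \<subseteq>\<^sub>m V" if "\<forall>W\<in>\<W>. W \<subseteq>\<^sub>m V" for V
  proof -
    have "countable K" "K \<subseteq> \<W>"
      using K by (auto simp: \<K>_def)
    with that have "AE x in lborel. \<forall>W\<in>K. x \<in> W \<longrightarrow> x \<in> V"
      by (subst AE_ball_countable) (auto simp: subset_mod_def)
    then show ?thesis
      unfolding subset_mod_def by eventually_elim auto
  qed
  ultimately have "is_measurable_union \<W> (\<Union>K)"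
    using borel_K[OF K] by (auto simp: is_measurable_union_def)
  then show ?thesis ..
qed

lemma is_measurable_union_measurable_union:
  "\<W> \<subseteq> sets borel \<Longrightarrow> is_measurable_union \<W> (measurable_union \<W>)"
  unfolding measurable_union_def by (rule someI_ex) (rule ex_is_measurable_union)

definition wandering :: "(real \<Rightarrow> real) \<Rightarrow> real set \<Rightarrow> bool"
  where "wandering T W \<longleftrightarrow> W \<in> sets borel \<and>
    (\<forall>i j. i \<noteq> j \<longrightarrow> (T ^^ i) -` W \<inter> (T ^^ j) -` W =\<^sub>m {})"

definition dissipative_part :: "(real \<Rightarrow> real) \<Rightarrow> real set"
  where "dissipative_part T = measurable_union {W. wandering T W}"

definition conservative_part :: "(real \<Rightarrow> real) \<Rightarrow> real set"
  where "conservative_part T = - dissipative_part T"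

definition invariant_hull :: "(real \<Rightarrow> real) \<Rightarrow> real set \<Rightarrow> real set"
  where "invariant_hull T A = (\<Union>k\<in>{1..}. \<Union>n. (T ^^ k) -` ((T ^^ n) ` A))"

definition I_CD :: "(real \<Rightarrow> real) \<Rightarrow> real set"
  where "I_CD T = invariant_hull T (conservative_part T) \<inter> invariant_hull T (dissipative_part T)"

definition I_C :: "(real \<Rightarrow> real) \<Rightarrow> real set"
  where "I_C T = invariant_hull T (conservative_part T) - I_CD T"

definition invariant_set :: "(real \<Rightarrow> real) \<Rightarrow> real set \<Rightarrow> bool"
  where "invariant_set S A \<longleftrightarrow> A \<in> sets borel \<and> S -` A =\<^sub>m A"

definition ergodic_component :: "(real \<Rightarrow> real) \<Rightarrow> real set \<Rightarrow> bool"
  where "ergodic_component S A \<longleftrightarrow>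
    invariant_set S A \<and> 0 < emeasure lborel A \<and>
    (\<forall>B. invariant_set S B \<and> B \<subseteq>\<^sub>m A \<longrightarrow> B =\<^sub>m {} \<or> B =\<^sub>m A)"

text \<open>
  The sets in the intersection of the sigma-algebras of the Borel subsets of \<open>A\<close> pulled back
  by the iterates of \<open>S\<close> restricted to \<open>A\<close>. Since \<open>A\<close> is \<open>S\<close>-invariant only modulo null sets,
  the preimage of \<open>B\<close> under the \<open>n\<close>-th iterate of the restriction is \<open>A \<inter> (S ^^ n) -` B\<close>, with
  equality modulo null sets.
\<close>

definition tail_sets :: "(real \<Rightarrow> real) \<Rightarrow> real set \<Rightarrow> real set set"
  where "tail_sets S A =
    (\<Inter>n. {E \<in> sets borel. E \<subseteq> A \<and> (\<exists>B\<in>sets borel. B \<subseteq> A \<and> E =\<^sub>m A \<inter> (S ^^ n) -` B)})"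

definition exact_component :: "(real \<Rightarrow> real) \<Rightarrow> real set \<Rightarrow> bool"
  where "exact_component S A \<longleftrightarrow>
    ergodic_component S A \<and> (\<forall>E\<in>tail_sets S A. E =\<^sub>m {} \<or> E =\<^sub>m A)"

definition markov_interval :: "(int \<Rightarrow> real) \<Rightarrow> int \<Rightarrow> real set"
  where "markov_interval a j = {a j..a (j + 1)}"

definition markov_algebra :: "(int \<Rightarrow> real) \<Rightarrow> real set set"
  where "markov_algebra a = sigma_sets UNIV (range (markov_interval a))"

definition period :: "(int \<Rightarrow> real) \<Rightarrow> (real \<Rightarrow> real) \<Rightarrow> int \<Rightarrow> nat"
  where "period a T j =
    Gcd {n. 1 \<le> n \<and> markov_interval a j \<subseteq>\<^sub>m (T ^^ n) ` markov_interval a j}"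

text \<open>
  A surjective Markov map with constants \<open>\<theta>\<close>, \<open>c\<close> (the lower bound of the derivatives) and \<open>\<eta>\<close>.
  Here \<open>\<tau> j\<close> is the extension to the closed \<open>j\<close>-th interval of the restriction of \<open>T\<close> to its
  interior (uniquely determined there, by continuity), and \<open>\<tau>' j\<close>, \<open>\<tau>'' j\<close> are its first two
  derivatives, one-sided at the endpoints. Nothing is assumed about \<open>T\<close> at the points \<open>a j\<close>.
\<close>

locale surjective_markov_map =
  fixes a :: "int \<Rightarrow> real" and T :: "real \<Rightarrow> real"
    and \<tau> \<tau>' \<tau>'' :: "int \<Rightarrow> real \<Rightarrow> real"
    and k\<^sub>1 k\<^sub>2 :: "int \<Rightarrow> int" and \<theta> c \<eta> :: real
  assumes a_at_top: "filterlim a at_top at_top"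
    and a_at_bot: "filterlim a at_bot at_bot"
    and theta_pos: "0 < \<theta>"
    and gap: "0 < a (j + 1) - a j" "a (j + 1) - a j \<le> \<theta>"
    and branch_eq: "x \<in> {a j<..<a (j + 1)} \<Longrightarrow> \<tau> j x = T x"
    and k_le: "k\<^sub>1 j \<le> k\<^sub>2 j"
    and branch_bij:
      "bij_betw (\<tau> j) (markov_interval a j) (\<Union>k\<in>{k\<^sub>1 j..k\<^sub>2 j}. markov_interval a k)"
    and branch_deriv: "x \<in> markov_interval a j \<Longrightarrow>
      (\<tau> j has_real_derivative \<tau>' j x) (at x within markov_interval a j)"
    and branch_deriv2: "x \<in> markov_interval a j \<Longrightarrow>
      (\<tau>' j has_real_derivative \<tau>'' j x) (at x within markov_interval a j)"
    and c_gt_1: "1 < c"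
    and expanding: "x \<in> markov_interval a j \<Longrightarrow> c \<le> \<bar>\<tau>' j x\<bar>"
    and eta_pos: "0 < \<eta>"
    and distortion: "x \<in> markov_interval a j \<Longrightarrow> \<bar>\<tau>'' j x / (\<tau>' j x)\<^sup>2\<bar> \<le> \<eta>"
    and surjective: "\<exists>j. markov_interval a k \<subseteq>\<^sub>m T ` markov_interval a j"

end

theory Submission
  imports Defs "HOL-Number_Theory.Cong"
begin

text \<open>
  On \<open>I_C T\<close> almost every point of a Markov interval returns to it infinitely often, along
  cylinders that shrink uniformly and on which the iterates of \<open>T\<close> have bounded distortion.
  Hence, if \<open>A = T\<^sup>-\<^sup>n B\<close> meets a Markov interval \<open>I\<close> in positive measure, then at suitable return
  times \<open>n\<close> the set \<open>B\<close> fills \<open>I\<close> up to arbitrarily small measure. For invariant \<open>A\<close> this means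
  that \<open>A\<close> is a union of Markov intervals, so the ergodic components are read off the transition
  graph, whose reachability relation is symmetric on \<open>I_C T\<close> by recurrence. With \<open>d\<close> the period of
  \<open>I\<close>, there are return paths of lengths \<open>q\<close> and \<open>q + d\<close>; they show that a non-null tail set \<open>A\<close> of
  a cyclic class always overlaps \<open>T\<^sup>-\<^sup>d A\<close>. Applied to \<open>A - T\<^sup>-\<^sup>d A\<close> and \<open>T\<^sup>-\<^sup>d A - A\<close>, this makes
  every tail set \<open>T\<^sup>d\<close>-invariant, hence null or the whole class.
\<close>

section \<open>Inverse branches and distortion\<close>

text \<open>The images of the branches are finite unions of Markov intervals, but their lengths need
  not be bounded uniformly. Distortion is therefore controlled over one final cell only: an iterate
  maps a nonempty cylinder \<open>cyl (u @ [k])\<close> bijectively onto \<open>cell k\<close>,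
  whose length is at most \<open>\<theta>\<close>. This is why the argument needs arbitrarily late
  returns to one fixed cell and not mere expansion. For an invariant set the set filling the cell is
  always the same. For a tail set it changes with the time, and nothing relates the sets belonging
  to different times. Two consequences shape the proof. A good time must be found from
  \<open>A\<close> alone, before \<open>B\<close> is known. And \<open>B\<close> can only be
  compared with its own preimage under \<open>T ^^ d\<close>: if along two return paths whose
  lengths differ by \<open>d\<close> both of these sets are forced to occupy more than half of the
  same cell, they must meet. The two paths are fixed in advance, since the accuracy required of the
  filling depends on the sizes of their cylinders.\<close>

context surjective_markov_map
begin

text \<open>Open intervals, because the values of \<open>T\<close> at the points \<open>a j\<close>
  are arbitrary: injectivity, derivatives and itineraries are available only away from them.\<close>

definition cell :: "int \<Rightarrow> real set" where "cell j = {a j<..<a (j + 1)}"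

lemma strict_mono_a: "strict_mono a"
proof (rule strict_monoI)
  fix i j :: int assume "i < j"
  then show "a i < a j"
  proof (induction j rule: int_gr_induct)
    case base then show ?case using gap(1)[of i] by simp
  next
    case (step j) then show ?case using gap(1)[of j] by simp
  qed
qed

lemmas a_less_iff [simp] = strict_mono_less[OF strict_mono_a]
lemmas a_le_iff [simp] = strict_mono_less_eq[OF strict_mono_a]

lemma open_cell [simp]: "open (cell j)"
  by (simp add: cell_def)

lemma cell_borel [measurable, simp]: "cell j \<in> sets borel"
  by (simp add: borel_open)

lemma cell_subset_markov_interval: "cell j \<subseteq> markov_interval a j"
  by (auto simp: cell_def markov_interval_def)

lemma cell_unique: "x \<in> cell i \<Longrightarrow> x \<in> cell j \<Longrightarrow> i = j"
proof -
  assume x: "x \<in> cell i" "x \<in> cell j"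
  then have "a i < a (j + 1)" "a j < a (i + 1)"
    by (auto simp: cell_def simp del: a_less_iff)
  then show ?thesis by simp
qed

lemma cell_cover: "(\<exists>j. x \<in> cell j) \<or> x \<in> range a"
proof -
  have "\<forall>\<^sub>F j in at_bot. a j \<le> x" "\<forall>\<^sub>F j in at_top. x < a j"
    using a_at_bot a_at_top by (auto simp: filterlim_at_bot filterlim_at_top_dense)
  then obtain l u where lu: "a l \<le> x" "x < a u"
    by (auto simp: eventually_at_bot_linorder eventually_at_top_linorder)
  then have "l < u" using a_less_iff order_le_less_trans by blast
  have "\<exists>j. a j \<le> x \<and> x < a (j + 1)"
  proof (rule ccontr)
    assume *: "\<not> ?thesis"
    have "a j \<le> x" if "l \<le> j" for j
      using that
    proof (induction j rule: int_ge_induct)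
      case base then show ?case using lu by simp
    next
      case (step j) then show ?case using * by force
    qed
    from this[of u] lu \<open>l < u\<close> show False by simp
  qed
  then show ?thesis unfolding cell_def by (metis greaterThanLessThan_iff order_le_less rangeI)
qed

lemma cell_not_end: "x \<in> cell j \<Longrightarrow> x \<notin> range a"
  by (auto simp: cell_def)

lemma cell_nonempty: "cell j \<noteq> {}"
  using gap(1)[of j] by (simp add: cell_def)

lemma emeasure_cell: "emeasure lborel (cell j) = ennreal (a (j + 1) - a j)"
  using gap(1)[of j] by (simp add: cell_def)

lemma cell_pos: "0 < emeasure lborel (cell j)" and cell_finite: "emeasure lborel (cell j) < \<infinity>"
  using gap(1)[of j] by (auto simp: emeasure_cell)

lemma cell_dist: "x \<in> cell j \<Longrightarrow> y \<in> cell j \<Longrightarrow> \<bar>x - y\<bar> \<le> \<theta>"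
  using gap(2)[of j] by (auto simp: cell_def)

section \<open>Transitions between cells\<close>

definition edge :: "int \<Rightarrow> int \<Rightarrow> bool" where "edge j k \<longleftrightarrow> k\<^sub>1 j \<le> k \<and> k \<le> k\<^sub>2 j"

definition target :: "int \<Rightarrow> real set" where "target j = {a (k\<^sub>1 j)<..<a (k\<^sub>2 j + 1)}"

lemma open_target [simp]: "open (target j)"
  by (simp add: target_def)

lemma cell_subset_target: "edge j k \<Longrightarrow> cell k \<subseteq> target j"
proof
  fix x assume "edge j k" "x \<in> cell k"
  then have "a (k\<^sub>1 j) \<le> a k" "a (k + 1) \<le> a (k\<^sub>2 j + 1)" "a k < x" "x < a (k + 1)"
    by (auto simp: edge_def cell_def)
  then show "x \<in> target j" by (simp add: target_def del: a_le_iff)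
qed

text \<open>Markov property: the ends of \<open>target j\<close> are partition points, so a cell
  that meets it lies inside it.\<close>

lemma edge_if_cell_target: "x \<in> cell k \<Longrightarrow> x \<in> target j \<Longrightarrow> edge j k"
proof -
  assume x: "x \<in> cell k" "x \<in> target j"
  then have "a (k\<^sub>1 j) < a (k + 1)" "a k < a (k\<^sub>2 j + 1)" 
    by (auto simp: cell_def target_def simp del: a_less_iff)
  then show ?thesis by (simp add: edge_def)
qed

lemma ex_edge: "\<exists>k. edge j k"
  using k_le[of j] by (auto simp: edge_def)

lemma UN_markov_interval:
  "k \<le> l \<Longrightarrow> (\<Union>i\<in>{k..l}. markov_interval a i) = {a k..a (l + 1)}"
proof (induction l rule: int_ge_induct)
  case base then show ?case by (simp add: markov_interval_def)
next
  case (step l)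
  have "{k..l + 1} = insert (l + 1) {k..l}" using step by auto
  then have "(\<Union>i\<in>{k..l + 1}. markov_interval a i) = {a (l + 1)..a (l + 1 + 1)} \<union> {a k..a (l + 1)}"
    using step by (simp add: markov_interval_def)
  also have "\<dots> = {a k..a (l + 1 + 1)}"
  proof -
    have "a k \<le> a (l + 1)" "a (l + 1) \<le> a (l + 1 + 1)" using step by auto
    then show ?thesis by (metis ivl_disj_un_two_touch(4) sup_commute)
  qed
  finally show ?case .
qed

text \<open>\<open>\<tau>' j\<close> is differentiable, hence continuous, so its range is connected
  and cannot jump over the gap between \<open>-c\<close> and \<open>c\<close>. The sign
  \<open>s\<close> lets both orientations be treated at once.\<close>

lemma branch_sign:
  obtains s :: real where "\<bar>s\<bar> = 1" "\<And>x. x \<in> markov_interval a j \<Longrightarrow> c \<le> s * \<tau>' j x"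
proof -
  have "continuous_on (markov_interval a j) (\<tau>' j)"
    using branch_deriv2 by (intro DERIV_continuous_on) blast
  then have con: "connected (\<tau>' j ` markov_interval a j)"
    by (intro connected_continuous_image) (auto simp: markov_interval_def)
  have ab: "c \<le> \<tau>' j x \<or> c \<le> - \<tau>' j x" if "x \<in> markov_interval a j" for x
    using expanding[OF that] by linarith
  have "(\<forall>x\<in>markov_interval a j. c \<le> \<tau>' j x) \<or> (\<forall>x\<in>markov_interval a j. c \<le> - \<tau>' j x)"
  proof (rule ccontr)
    assume "\<not> ?thesis"
    then obtain x y where xy: "x \<in> markov_interval a j" "c \<le> - \<tau>' j x"
      "y \<in> markov_interval a j" "c \<le> \<tau>' j y"
      using ab by blast
    have "0 \<in> \<tau>' j ` markov_interval a j"
      by (rule connectedD_interval[OF con, of "\<tau>' j x" "\<tau>' j y"]) (use xy c_gt_1 in auto)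
    then obtain z where "z \<in> markov_interval a j" "\<tau>' j z = 0" by auto
    with expanding[of z j] c_gt_1 show False by simp
  qed
  then show thesis
  proof
    assume "\<forall>x\<in>markov_interval a j. c \<le> \<tau>' j x"
    then show thesis by (intro that[of 1]) auto
  next
    assume "\<forall>x\<in>markov_interval a j. c \<le> - \<tau>' j x"
    then show thesis by (intro that[of "-1"]) auto
  qed
qed

lemma branch_mvt:
  assumes "x \<in> markov_interval a j" "y \<in> markov_interval a j" "x < y"
    and f: "\<And>z. z \<in> markov_interval a j \<Longrightarrow> (f has_real_derivative f' z) (at z within markov_interval a j)"
  obtains z where "z \<in> markov_interval a j" "f y - f x = f' z * (y - x)"
proof -
  have sub: "{x..y} \<subseteq> markov_interval a j" using assms by (auto simp: markov_interval_def)
  have "\<exists>z\<in>{x<..<y}. f y - f x = f' z * (y - x)"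
  proof (rule mvt_simple[OF \<open>x < y\<close>])
    fix z assume "x \<le> z" "z \<le> y"
    then have "(f has_real_derivative f' z) (at z within markov_interval a j)"
      using sub f by auto
    then show "(f has_derivative (*) (f' z)) (at z within {x..y})"
      using sub has_derivative_subset unfolding has_field_derivative_def by blast
  qed
  then show thesis using that sub by (meson atLeastAtMost_iff greaterThanLessThan_iff less_imp_le subsetD)
qed

lemma branch_expand:
  assumes "x \<in> markov_interval a j" "y \<in> markov_interval a j"
  shows "c * \<bar>x - y\<bar> \<le> \<bar>\<tau> j x - \<tau> j y\<bar>"
  using assms
proof (induction x y rule: linorder_wlog)
  case (le x y)
  show ?case
  proof (cases "x < y")
    case True
    from branch_mvt[OF le(2,3) True branch_deriv] obtain z where
      z: "z \<in> markov_interval a j" "\<tau> j y - \<tau> j x = \<tau>' j z * (y - x)" by blast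
    then show ?thesis using expanding[OF z(1)] True
      by (simp add: abs_minus_commute[of x] abs_minus_commute[of "\<tau> j x"] abs_mult mult_right_mono)
  qed (use le in auto)
next
  case (sym x y) then show ?case by (simp add: abs_minus_commute)
qed

text \<open>The derivative \<open>\<tau>'' j / \<tau>' j\<close> of
  \<open>ln \<bar>\<tau>' j\<bar>\<close> is bounded in absolute value by
  \<open>\<eta> * \<bar>\<tau>' j\<bar>\<close>, the derivative of
  \<open>\<eta> * (s * \<tau> j)\<close>. As \<open>\<tau>'' j\<close> is not assumed integrable,
  the two functions are compared by the mean value theorem instead of by integration.\<close>

lemma branch_distortion:
  assumes "x \<in> markov_interval a j" "y \<in> markov_interval a j"
  shows "\<bar>\<tau>' j x\<bar> \<le> exp (\<eta> * \<bar>\<tau> j x - \<tau> j y\<bar>) * \<bar>\<tau>' j y\<bar>"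
proof -
  obtain s where s: "\<bar>s\<bar> = 1" "\<And>x. x \<in> markov_interval a j \<Longrightarrow> c \<le> s * \<tau>' j x"
    using branch_sign by blast
  have pos: "0 < s * \<tau>' j x" if "x \<in> markov_interval a j" for x
    using s(2)[OF that] c_gt_1 by linarith
  have ab: "\<bar>\<tau>' j x\<bar> = s * \<tau>' j x" if "x \<in> markov_interval a j" for x
    using pos[OF that] s(1) by (metis abs_mult abs_of_pos mult_1)
  have main: "\<bar>ln \<bar>\<tau>' j y\<bar> - ln \<bar>\<tau>' j x\<bar>\<bar> \<le> \<eta> * \<bar>\<tau> j y - \<tau> j x\<bar>"
    if xy: "x \<in> markov_interval a j" "y \<in> markov_interval a j" "x < y" for x y
  proof -
    define L where "L z = ln (s * \<tau>' j z)" for z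
    have dL: "(L has_real_derivative \<tau>'' j z / \<tau>' j z) (at z within markov_interval a j)"
      if "z \<in> markov_interval a j" for z
    proof -
      have "((\<lambda>z. s * \<tau>' j z) has_real_derivative s * \<tau>'' j z) (at z within markov_interval a j)"
        by (intro DERIV_cmult branch_deriv2 that)
      with pos[OF that] have "(L has_real_derivative 1 / (s * \<tau>' j z) * (s * \<tau>'' j z)) (at z within markov_interval a j)"
        unfolding L_def by (intro DERIV_chain2[where f = ln] DERIV_ln_divide) auto
      moreover have "1 / (s * \<tau>' j z) * (s * \<tau>'' j z) = \<tau>'' j z / \<tau>' j z"
        using s(1) by auto
      ultimately show ?thesis by simp
    qed
    have bd: "\<bar>\<tau>'' j z / \<tau>' j z\<bar> \<le> \<eta> * (s * \<tau>' j z)" if "z \<in> markov_interval a j" for z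
    proof -
      have "\<tau>' j z \<noteq> 0" using pos[OF that] by auto
      then have "\<bar>\<tau>'' j z / \<tau>' j z\<bar> = \<bar>\<tau>'' j z / (\<tau>' j z)\<^sup>2\<bar> * \<bar>\<tau>' j z\<bar>"
        by (simp add: abs_mult power2_eq_square field_simps)
      also have "\<dots> \<le> \<eta> * \<bar>\<tau>' j z\<bar>"
        by (intro mult_right_mono distortion that) auto
      finally show ?thesis by (simp only: ab[OF that])
    qed
    \<comment> \<open>For \<open>e = 1\<close> this function does not decrease and for
      \<open>e = -1\<close> it does not increase; together this bounds the variation of
      \<open>L\<close>.\<close>
    have d1: "((\<lambda>z. L z + e * (\<eta> * (s * \<tau> j z))) has_real_derivative
         \<tau>'' j z / \<tau>' j z + e * (\<eta> * (s * \<tau>' j z))) (at z within markov_interval a j)"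
      if "z \<in> markov_interval a j" for z e
      by (intro DERIV_add dL DERIV_cmult branch_deriv that)
    have d2: "\<exists>z. z \<in> markov_interval a j \<and>
       (L y + e * (\<eta> * (s * \<tau> j y))) - (L x + e * (\<eta> * (s * \<tau> j x)))
        = (\<tau>'' j z / \<tau>' j z + e * (\<eta> * (s * \<tau>' j z))) * (y - x)" for e
      by (rule branch_mvt[OF xy, where f = "\<lambda>z. L z + e * (\<eta> * (s * \<tau> j z))"
          and f' = "\<lambda>z. \<tau>'' j z / \<tau>' j z + e * (\<eta> * (s * \<tau>' j z))"]) (auto intro: d1)
    obtain v where v: "v \<in> markov_interval a j" "\<tau> j y - \<tau> j x = \<tau>' j v * (y - x)"
      using branch_mvt[OF xy branch_deriv] by blast
    obtain z where z: "z \<in> markov_interval a j"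
      "(L y + 1 * (\<eta> * (s * \<tau> j y))) - (L x + 1 * (\<eta> * (s * \<tau> j x)))
        = (\<tau>'' j z / \<tau>' j z + 1 * (\<eta> * (s * \<tau>' j z))) * (y - x)"
      using d2 by blast
    obtain w where w: "w \<in> markov_interval a j"
      "(L y + (-1) * (\<eta> * (s * \<tau> j y))) - (L x + (-1) * (\<eta> * (s * \<tau> j x)))
        = (\<tau>'' j w / \<tau>' j w + (-1) * (\<eta> * (s * \<tau>' j w))) * (y - x)"
      using d2 by blast
    have "0 \<le> \<tau>'' j z / \<tau>' j z + 1 * (\<eta> * (s * \<tau>' j z))"
      "\<tau>'' j w / \<tau>' j w + (-1) * (\<eta> * (s * \<tau>' j w)) \<le> 0"
      using bd[OF z(1)] bd[OF w(1)] by linarith+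
    then have "0 \<le> (L y + 1 * (\<eta> * (s * \<tau> j y))) - (L x + 1 * (\<eta> * (s * \<tau> j x)))"
      "(L y + (-1) * (\<eta> * (s * \<tau> j y))) - (L x + (-1) * (\<eta> * (s * \<tau> j x))) \<le> 0"
      unfolding z(2) w(2) using xy(3) by (auto intro: mult_nonneg_nonneg mult_nonpos_nonneg)
    then have "\<bar>L y - L x\<bar> \<le> \<eta> * (s * (\<tau> j y - \<tau> j x))"
      by (simp add: algebra_simps abs_le_iff)
    also have "s * (\<tau> j y - \<tau> j x) = \<bar>\<tau> j y - \<tau> j x\<bar>"
      using xy(3) by (simp add: v(2) abs_mult ab[OF v(1)])
    finally show ?thesis by (simp only: L_def ab[OF xy(1)] ab[OF xy(2)])
  qed
  have "ln \<bar>\<tau>' j x\<bar> - ln \<bar>\<tau>' j y\<bar> \<le> \<eta> * \<bar>\<tau> j x - \<tau> j y\<bar>"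
    using main[of x y] main[of y x] assms
    by (cases x y rule: linorder_cases) (auto simp: abs_minus_commute)
  then have "exp (ln \<bar>\<tau>' j x\<bar>) \<le> exp (\<eta> * \<bar>\<tau> j x - \<tau> j y\<bar> + ln \<bar>\<tau>' j y\<bar>)"
    by simp
  moreover have "\<bar>\<tau>' j x\<bar> > 0" "\<bar>\<tau>' j y\<bar> > 0"
    using ab pos assms by auto
  ultimately show ?thesis
    by (simp add: exp_add)
qed

text \<open>A monotone bijection sends the two ends of the interval to the two ends of its image,
  possibly swapped; removing them leaves the open intervals.\<close>

lemma branch_image_cell: "\<tau> j ` cell j = target j"
proof -
  let ?I = "markov_interval a j"
  have J: "\<tau> j ` ?I = {a (k\<^sub>1 j)..a (k\<^sub>2 j + 1)}"
    using branch_bij[of j] k_le[of j] by (simp add: bij_betw_def UN_markov_interval)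
  have inj: "inj_on (\<tau> j) ?I" using branch_bij[of j] by (simp add: bij_betw_def)
  obtain s where s: "\<bar>s\<bar> = 1" "\<And>x. x \<in> ?I \<Longrightarrow> c \<le> s * \<tau>' j x"
    using branch_sign by blast
  have mono: "s * \<tau> j x \<le> s * \<tau> j y" if xy: "x \<in> ?I" "y \<in> ?I" "x \<le> y" for x y
  proof (cases "x < y")
    case True
    from branch_mvt[OF xy(1,2) True branch_deriv] obtain z where
      z: "z \<in> ?I" "\<tau> j y - \<tau> j x = \<tau>' j z * (y - x)" by blast
    have "0 \<le> (s * \<tau>' j z) * (y - x)"
      by (rule mult_nonneg_nonneg) (use s(2)[OF z(1)] c_gt_1 True in auto)
    then show ?thesis using z(2) by (metis diff_ge_0_iff_ge mult.assoc right_diff_distrib)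
  qed (use xy in simp)
  have ends: "a j \<in> ?I" "a (j + 1) \<in> ?I" using gap(1)[of j] by (auto simp: markov_interval_def)
  have le: "s * \<tau> j (a j) \<le> s * t" "s * t \<le> s * \<tau> j (a (j + 1))" if "t \<in> \<tau> j ` ?I" for t
    using that ends mono by (auto simp: markov_interval_def)
  have kk: "a (k\<^sub>1 j) \<le> a (k\<^sub>2 j + 1)" using k_le[of j] by simp
  have "{\<tau> j (a j), \<tau> j (a (j + 1))} = {a (k\<^sub>1 j), a (k\<^sub>2 j + 1)}"
  proof -
    have m: "a (k\<^sub>1 j) \<in> \<tau> j ` ?I" "a (k\<^sub>2 j + 1) \<in> \<tau> j ` ?I" using J kk by auto
    have in': "\<tau> j (a j) \<in> {a (k\<^sub>1 j)..a (k\<^sub>2 j + 1)}" "\<tau> j (a (j + 1)) \<in> {a (k\<^sub>1 j)..a (k\<^sub>2 j + 1)}"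
      using J ends by auto
    have "s = 1 \<or> s = -1" using s(1) by linarith
    then show ?thesis using le[OF m(1)] le[OF m(2)] in' by auto
  qed
  moreover have "cell j = ?I - {a j, a (j + 1)}"
    by (auto simp: cell_def markov_interval_def)
  ultimately have "\<tau> j ` cell j = {a (k\<^sub>1 j)..a (k\<^sub>2 j + 1)} - {a (k\<^sub>1 j), a (k\<^sub>2 j + 1)}"
    using inj_on_image_set_diff[OF inj, of ?I "{a j, a (j + 1)}"] ends J by auto
  then show ?thesis unfolding target_def by auto
qed

lemma T_eq_branch: "x \<in> cell j \<Longrightarrow> T x = \<tau> j x"
  using branch_eq by (simp add: cell_def)

lemma T_image_cell: "T ` cell j = target j"
  using branch_image_cell[of j] T_eq_branch by (metis image_cong)

lemma inj_on_T_cell: "inj_on T (cell j)"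
proof -
  have "inj_on (\<tau> j) (cell j)"
    using branch_bij[of j] cell_subset_markov_interval unfolding bij_betw_def by (meson inj_on_subset)
  then show ?thesis using T_eq_branch by (metis inj_on_cong)
qed

lemma T_deriv:
  assumes "x \<in> cell j"
  shows "(T has_real_derivative \<tau>' j x) (at x)"
proof -
  have "(\<tau> j has_real_derivative \<tau>' j x) (at x within cell j)"
    using branch_deriv assms cell_subset_markov_interval by (meson DERIV_subset subsetD)
  then have "(\<tau> j has_real_derivative \<tau>' j x) (at x)"
    using assms at_within_open[OF assms open_cell] by simp
  then show ?thesis
    using has_field_derivative_transform_within_open[OF _ open_cell assms, of "\<tau> j" "\<tau>' j x" T]
      T_eq_branch by simp
qed

section \<open>Inverse branches of a single step\<close>

definition inv_branch :: "int \<Rightarrow> real \<Rightarrow> real" where "inv_branch j = inv_into (cell j) T"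

definition inv_deriv :: "int \<Rightarrow> real \<Rightarrow> real" where "inv_deriv j t = inverse (\<tau>' j (inv_branch j t))"

lemma inv_branch_in: "t \<in> target j \<Longrightarrow> inv_branch j t \<in> cell j"
  and T_inv_branch: "t \<in> target j \<Longrightarrow> T (inv_branch j t) = t"
  unfolding inv_branch_def T_image_cell[symmetric] by (auto intro: inv_into_into f_inv_into_f)

lemma inv_branch_T: "x \<in> cell j \<Longrightarrow> inv_branch j (T x) = x"
  unfolding inv_branch_def by (rule inv_into_f_f[OF inj_on_T_cell])

lemma inv_branch_contract:
  assumes "s \<in> target j" "t \<in> target j"
  shows "\<bar>inv_branch j s - inv_branch j t\<bar> \<le> \<bar>s - t\<bar> / c"
proof -
  have i: "inv_branch j s \<in> cell j" "inv_branch j t \<in> cell j" using assms by (auto intro: inv_branch_in)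
  then have "c * \<bar>inv_branch j s - inv_branch j t\<bar> \<le> \<bar>\<tau> j (inv_branch j s) - \<tau> j (inv_branch j t)\<bar>"
    using cell_subset_markov_interval by (intro branch_expand) auto
  also have "\<dots> = \<bar>s - t\<bar>" using i assms T_inv_branch by (simp flip: T_eq_branch)
  finally show ?thesis using c_gt_1 by (simp add: field_simps)
qed

lemma inv_branch_deriv:
  assumes "t \<in> target j"
  shows "(inv_branch j has_real_derivative inv_deriv j t) (at t)"
proof -
  have i: "inv_branch j t \<in> cell j" by (rule inv_branch_in[OF assms])
  \<comment> \<open>The inverse function rule asks for continuity of the inverse beforehand;
    expansion makes the inverse Lipschitz.\<close>
  have "continuous_on (target j) (inv_branch j)"
  proof (rule lipschitz_on_continuous_on)
    show "(1 / c)-lipschitz_on (target j) (inv_branch j)"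
      using c_gt_1 inv_branch_contract by (intro lipschitz_onI) (auto simp: dist_real_def)
  qed
  then have "isCont (inv_branch j) t"
    using assms by (simp add: continuous_on_eq_continuous_at)
  moreover have "\<tau>' j (inv_branch j t) \<noteq> 0"
    using expanding[of "inv_branch j t" j] i cell_subset_markov_interval c_gt_1 by fastforce
  ultimately show ?thesis
    using assms T_inv_branch T_deriv[OF i] unfolding inv_deriv_def
    by (intro DERIV_inverse_function[where f = T and a = "a (k\<^sub>1 j)" and b = "a (k\<^sub>2 j + 1)"])
      (auto simp: target_def)
qed

lemma inv_deriv_nonzero:
  assumes "t \<in> target j"
  shows "inv_deriv j t \<noteq> 0"
proof -
  have "c \<le> \<bar>\<tau>' j (inv_branch j t)\<bar>"
    using expanding inv_branch_in[OF assms] cell_subset_markov_interval by blast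
  then show ?thesis
    using c_gt_1 unfolding inv_deriv_def by auto
qed

text \<open>The exponent involves the distance of the arguments of the inverse branch. Along a word
  these distances decay geometrically, so the exponents can be summed.\<close>

lemma inv_deriv_distortion:
  assumes "s \<in> target j" "t \<in> target j"
  shows "\<bar>inv_deriv j s\<bar> \<le> exp (\<eta> * \<bar>s - t\<bar>) * \<bar>inv_deriv j t\<bar>"
proof -
  let ?x = "inv_branch j s" and ?y = "inv_branch j t"
  have i: "?x \<in> cell j" "?y \<in> cell j" using assms by (auto intro: inv_branch_in)
  then have m: "?x \<in> markov_interval a j" "?y \<in> markov_interval a j"
    using cell_subset_markov_interval by auto
  have "\<bar>\<tau>' j ?y\<bar> \<le> exp (\<eta> * \<bar>\<tau> j ?y - \<tau> j ?x\<bar>) * \<bar>\<tau>' j ?x\<bar>"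
    by (rule branch_distortion[OF m(2,1)])
  also have "\<bar>\<tau> j ?y - \<tau> j ?x\<bar> = \<bar>s - t\<bar>"
    using i assms T_inv_branch by (simp add: abs_minus_commute flip: T_eq_branch)
  finally show ?thesis
    using expanding[OF m(1)] expanding[OF m(2)] c_gt_1 unfolding inv_deriv_def
    by (simp add: field_simps)
qed

end

section \<open>Null sets and cylinders\<close>

text \<open>Almost everywhere statements combine easily, while the theorems on differentiable images
  of null sets speak of \<open>negligible\<close>, which also admits sets that are not
  Borel.\<close>

lemma AE_lborel_iff_negligible: "(AE x in lborel. P x) \<longleftrightarrow> negligible {x. \<not> P x}"
proof -
  have "(AE x in lborel. P x) \<longleftrightarrow> (AE x in lebesgue. P x)"
    by (rule AE_completion_iff[symmetric])
  also have "\<dots> \<longleftrightarrow> negligible {x. \<not> P x}"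
    by (simp add: negligible_iff_null_sets completion.AE_iff_null_sets)
  finally show ?thesis .
qed

lemma negligible_iff_AE: "negligible N \<longleftrightarrow> (AE x in lborel. x \<notin> N)"
  by (simp add: AE_lborel_iff_negligible)

lemma negligible_borel_iff: "N \<in> sets borel \<Longrightarrow> negligible N \<longleftrightarrow> emeasure lborel N = 0"
  by (simp add: negligible_iff_null_sets null_sets_completion_iff) (simp add: null_sets_def)

lemma countable_negligible: "countable N \<Longrightarrow> negligible (N :: real set)"
  by (simp add: negligible_iff_null_sets null_sets_completionI countable_imp_null_set_lborel)

context surjective_markov_map
begin

lemma negligible_ends [simp]: "negligible (range a)"
  by (simp add: countable_negligible)

lemma borel_T_cell: "open S \<Longrightarrow> cell j \<inter> T -` S \<in> sets borel"
proof -
  assume "open S"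
  have "continuous_on (cell j) T"
    using T_deriv by (meson DERIV_continuous_on has_field_derivative_at_within)
  then show ?thesis
    using \<open>open S\<close> by (intro borel_open continuous_open_preimage) auto
qed

lemma T_measurable [measurable]: "T \<in> borel_measurable borel"
proof (rule borel_measurableI)
  fix S :: "real set" assume "open S"
  have "T -` S = (\<Union>j. cell j \<inter> T -` S) \<union> (range a \<inter> T -` S)"
    using cell_cover by blast
  moreover have "countable (range a \<inter> T -` S)"
    by simp
  then have "range a \<inter> T -` S \<in> sets borel"
    by (rule sets.countable[rotated]) simp
  moreover have "(\<Union>j. cell j \<inter> T -` S) \<in> sets borel"
    using borel_T_cell[OF \<open>open S\<close>] by (intro sets.countable_UN'') auto
  ultimately have "T -` S \<in> sets borel"
    using sets.Un by metis
  then show "T -` S \<inter> space borel \<in> sets borel"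
    by simp
qed

lemma Tn_measurable [measurable]: "T ^^ n \<in> borel_measurable borel"
proof (induction n)
  case (Suc n)
  then show ?case by simp
qed (simp add: id_def)

lemma Tn_vimage_borel: "B \<in> sets borel \<Longrightarrow> (T ^^ n) -` B \<in> sets borel"
  using measurable_sets[OF Tn_measurable, of B n] by simp

text \<open>On a cell the image is a preimage under the continuous inverse branch. Forward images
  must be Borel because \<open>invariant_hull\<close> is built from them.\<close>

lemma T_cell_image_borel:
  assumes "B \<in> sets borel"
  shows "T ` (B \<inter> cell j) \<in> sets borel"
proof -
  have eq: "T ` (B \<inter> cell j) = {t \<in> target j. inv_branch j t \<in> B}"
  proof (intro set_eqI iffI)
    fix t assume "t \<in> T ` (B \<inter> cell j)"
    then obtain x where "x \<in> B" "x \<in> cell j" "t = T x" by auto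
    then show "t \<in> {t \<in> target j. inv_branch j t \<in> B}"
      using T_image_cell[of j] inv_branch_T[of x j] by auto
  next
    fix t assume t: "t \<in> {t \<in> target j. inv_branch j t \<in> B}"
    then have "t = T (inv_branch j t)" "inv_branch j t \<in> B \<inter> cell j"
      using T_inv_branch inv_branch_in by auto
    then show "t \<in> T ` (B \<inter> cell j)" by blast
  qed
  have "continuous_on (target j) (inv_branch j)"
    using inv_branch_deriv by (meson DERIV_continuous_on has_field_derivative_at_within)
  then have "inv_branch j \<in> borel_measurable (restrict_space borel (target j))"
    by (rule borel_measurable_continuous_on_restrict)
  from measurable_sets[OF this assms]
  have "inv_branch j -` B \<inter> target j \<in> sets (restrict_space borel (target j))"
    by (simp add: space_restrict_space)
  then have "inv_branch j -` B \<inter> target j \<in> sets borel"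
    by (auto simp: sets_restrict_space borel_open)
  then show ?thesis
    unfolding eq by (simp add: vimage_def Int_def conj_commute)
qed

lemma image_eq_cells: "T ` B = (\<Union>j. T ` (B \<inter> cell j)) \<union> T ` (B \<inter> range a)"
proof -
  have "B = (\<Union>j. B \<inter> cell j) \<union> (B \<inter> range a)"
    using cell_cover by (intro set_eqI) (metis (no_types, lifting) Int_iff UN_iff UNIV_I Un_iff)
  then have "T ` B = T ` ((\<Union>j. B \<inter> cell j) \<union> (B \<inter> range a))"
    by (rule arg_cong)
  then show ?thesis by (simp only: image_Un image_UN)
qed

lemma T_image_borel:
  assumes "B \<in> sets borel"
  shows "T ` B \<in> sets borel"
proof -
  have "T ` (B \<inter> range a) \<in> sets borel"
    by (rule sets.countable[of "T ` (B \<inter> range a)"]) auto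
  moreover have "(\<Union>j. T ` (B \<inter> cell j)) \<in> sets borel"
    using T_cell_image_borel[OF assms] by (intro sets.countable_UN'') auto
  ultimately show ?thesis
    unfolding image_eq_cells[of B] by (rule sets.Un[rotated])
qed

lemma Tn_image_borel: "B \<in> sets borel \<Longrightarrow> (T ^^ n) ` B \<in> sets borel"
proof (induction n)
  case (Suc n)
  then show ?case using T_image_borel[of "(T ^^ n) ` B"] by (simp add: image_comp)
qed simp

lemma negligible_T_image:
  assumes "negligible N" shows "negligible (T ` N)"
proof -
  have "negligible (T ` (N \<inter> cell j))" for j
  proof (rule negligible_differentiable_image_negligible)
    show "negligible (N \<inter> cell j)" using assms by (rule negligible_subset) auto
    have "(T has_derivative (*) (\<tau>' j x)) (at x within N \<inter> cell j)" if "x \<in> cell j" for x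
      using T_deriv[OF that] by (auto simp: has_field_derivative_def intro: has_derivative_at_withinI)
    then show "T differentiable_on N \<inter> cell j"
      unfolding differentiable_on_def differentiable_def by blast
  qed simp
  moreover have "negligible (T ` (N \<inter> range a))"
    by (simp add: countable_negligible)
  ultimately show ?thesis
    unfolding image_eq_cells[of N] by (intro negligible_Un negligible_countable_Union) auto
qed

text \<open>Nonsingularity of \<open>T\<close>: it is what allows almost everywhere statements to be
  pulled back along iterates in \<open>AE_Tn\<close>.\<close>

lemma negligible_T_vimage:
  assumes "negligible N" shows "negligible (T -` N)"
proof -
  have "negligible (inv_branch j ` (N \<inter> target j))" for j
  proof (rule negligible_differentiable_image_negligible)
    show "negligible (N \<inter> target j)" using assms by (rule negligible_subset) auto
    have "(inv_branch j has_derivative (*) (inv_deriv j t)) (at t within N \<inter> target j)" if "t \<in> target j" for t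
      using inv_branch_deriv[OF that] by (auto simp: has_field_derivative_def intro: has_derivative_at_withinI)
    then show "inv_branch j differentiable_on N \<inter> target j"
      unfolding differentiable_on_def differentiable_def by blast
  qed simp
  then have "negligible ((\<Union>j. inv_branch j ` (N \<inter> target j)) \<union> range a)"
    by (intro negligible_Un negligible_countable_Union) auto
  moreover have "T -` N \<subseteq> (\<Union>j. inv_branch j ` (N \<inter> target j)) \<union> range a"
  proof
    fix x assume x: "x \<in> T -` N"
    show "x \<in> (\<Union>j. inv_branch j ` (N \<inter> target j)) \<union> range a"
    proof (cases "x \<in> range a")
      case False
      then obtain j where j: "x \<in> cell j" using cell_cover by blast
      then have "T x \<in> N \<inter> target j" "x = inv_branch j (T x)"
        using x T_image_cell[of j] inv_branch_T[OF j] by auto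
      then show ?thesis by blast
    qed simp
  qed
  ultimately show ?thesis by (rule negligible_subset)
qed

lemma negligible_Tn_image: "negligible N \<Longrightarrow> negligible ((T ^^ n) ` N)"
proof (induction n)
  case (Suc n)
  then show ?case using negligible_T_image[of "(T ^^ n) ` N"] by (simp add: image_comp)
qed simp

lemma negligible_Tn_vimage: "negligible N \<Longrightarrow> negligible ((T ^^ n) -` N)"
proof (induction n)
  case (Suc n)
  then show ?case using negligible_T_vimage[of "(T ^^ n) -` N"]
    by (simp add: vimage_comp comp_def funpow_Suc_right del: funpow.simps)
qed simp

lemma AE_Tn: "AE x in lborel. P x \<Longrightarrow> AE x in lborel. P ((T ^^ n) x)"
  using negligible_Tn_vimage[of "{x. \<not> P x}" n]
  by (simp add: AE_lborel_iff_negligible vimage_def)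

section \<open>Itineraries and cylinders\<close>

definition regular :: "real \<Rightarrow> bool" where "regular x \<longleftrightarrow> (\<forall>n. (T ^^ n) x \<notin> range a)"

lemma AE_regular: "AE x in lborel. regular x"
proof -
  have "AE x in lborel. x \<notin> range a"
    using negligible_ends unfolding negligible_iff_AE .
  then show ?thesis
    unfolding regular_def AE_all_countable by (intro allI AE_Tn)
qed

lemma regular_Tn: "regular x \<Longrightarrow> regular ((T ^^ n) x)"
  unfolding regular_def by (metis comp_apply funpow_add)

lemma regular_cell: "regular x \<Longrightarrow> \<exists>j. x \<in> cell j"
  unfolding regular_def using cell_cover by (metis funpow_0)

lemma T_step: "x \<in> cell j \<Longrightarrow> T x \<in> cell k \<Longrightarrow> edge j k"
  using T_image_cell[of j] edge_if_cell_target by blast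

lemma Tn_steps: "regular x \<Longrightarrow> x \<in> cell j \<Longrightarrow> (T ^^ n) x \<in> cell k \<Longrightarrow> (edge ^^ n) j k"
proof (induction n arbitrary: x j)
  case 0 then show ?case using cell_unique by auto
next
  case (Suc n)
  obtain i where i: "T x \<in> cell i" using regular_cell[OF regular_Tn[OF Suc.prems(1), of 1]] by auto
  have "(edge ^^ n) i k"
    using Suc.IH[OF _ i] Suc.prems regular_Tn[OF Suc.prems(1), of 1]
    by (simp add: funpow_Suc_right del: funpow.simps)
  then show ?case using T_step[OF Suc.prems(2) i] by (rule relpowp_Suc_I2[rotated])
qed

text \<open>Words are mostly written \<open>u @ [k]\<close>, so that the last letter is the cell
  occupied after exactly \<open>length u\<close> steps.\<close>

primrec cyl :: "int list \<Rightarrow> real set" where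
  "cyl [] = UNIV"
| "cyl (j # w) = {x \<in> cell j. T x \<in> cyl w}"

lemma cyl_borel [measurable, simp]: "cyl w \<in> sets borel"
proof (induction w)
  case (Cons j w)
  have "cyl (j # w) = cell j \<inter> (T ^^ 1) -` cyl w" by auto
  then show ?case using Tn_vimage_borel[OF Cons, of 1] by auto
qed simp

lemma in_cyl_iff: "x \<in> cyl w \<longleftrightarrow> (\<forall>i<length w. (T ^^ i) x \<in> cell (w ! i))"
proof (induction w arbitrary: x)
  case (Cons j w)
  have "(\<forall>i<length (j # w). (T ^^ i) x \<in> cell ((j # w) ! i)) \<longleftrightarrow>
    x \<in> cell j \<and> (\<forall>i<length w. (T ^^ Suc i) x \<in> cell (w ! i))"
    by (simp add: All_less_Suc2)
  then show ?case using Cons by (simp add: funpow_Suc_right del: funpow.simps)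
qed simp

lemma cyl_last: "x \<in> cyl (u @ [k]) \<Longrightarrow> (T ^^ length u) x \<in> cell k"
  by (auto simp: in_cyl_iff dest: spec[of _ "length u"])

lemma cyl_take_unique:
  assumes "x \<in> cyl w" "x \<in> cyl w'" "length w \<le> length w'"
  shows "take (length w) w' = w"
proof (rule nth_equalityI)
  fix i assume "i < length (take (length w) w')"
  then show "take (length w) w' ! i = w ! i"
    using assms cell_unique[of "(T ^^ i) x"] by (simp add: in_cyl_iff)
qed (use assms in simp)

lemma regular_word:
  assumes "regular x" "(T ^^ n) x \<in> cell k"
  obtains u where "length u = n" "x \<in> cyl (u @ [k])"
proof -
  have "\<forall>i. \<exists>j. (T ^^ i) x \<in> cell j"
    using regular_cell regular_Tn assms by blast
  then obtain f where f: "\<And>i. (T ^^ i) x \<in> cell (f i)" by metis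
  have "x \<in> cyl (map f [0..<n] @ [k])"
    using f assms(2) by (auto simp: in_cyl_iff nth_append less_Suc_eq)
  then show thesis by (intro that[of "map f [0..<n]"]) auto
qed

text \<open>Converse of \<open>Tn_steps\<close>, built backwards: a point following the rest of the
  path lies in the image of the first cell and is pulled back by \<open>inv_branch\<close>.\<close>

lemma path_word: "(edge ^^ n) j k \<Longrightarrow> \<exists>u. length u = n \<and> cyl (u @ [k]) \<noteq> {} \<and> cyl (u @ [k]) \<subseteq> cell j"
proof (induction n arbitrary: j)
  case 0
  then show ?case using cell_nonempty by (intro exI[of _ "[]"]) auto
next
  case (Suc n)
  from relpowp_Suc_D2[OF Suc.prems] obtain i where i: "edge j i" "(edge ^^ n) i k" by blast
  from Suc.IH[OF i(2)] obtain u y where u: "length u = n" "y \<in> cyl (u @ [k])" "cyl (u @ [k]) \<subseteq> cell i"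
    by blast
  then have "y \<in> target j" using cell_subset_target[OF i(1)] by blast
  then have "inv_branch j y \<in> cyl ((j # u) @ [k])"
    using u(2) by (simp add: inv_branch_in T_inv_branch)
  then show ?case using u(1) by (intro exI[of _ "j # u"]) auto
qed

section \<open>Inverse branches along a word\<close>

primrec inv_word :: "int list \<Rightarrow> real \<Rightarrow> real" where
  "inv_word [] t = t"
| "inv_word (j # u) t = inv_branch j (inv_word u t)"

primrec inv_word_deriv :: "int list \<Rightarrow> real \<Rightarrow> real" where
  "inv_word_deriv [] t = 1"
| "inv_word_deriv (j # u) t = inv_deriv j (inv_word u t) * inv_word_deriv u t"

lemma cyl_Cons_nonempty:
  assumes "cyl (j # u @ [k]) \<noteq> {}"
  shows "cyl (u @ [k]) \<noteq> {}" "cyl (u @ [k]) \<subseteq> target j"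
proof -
  obtain x where x: "x \<in> cell j" "T x \<in> cyl (u @ [k])" using assms by auto
  then show "cyl (u @ [k]) \<noteq> {}" by auto
  obtain i where i: "cyl (u @ [k]) \<subseteq> cell i" by (cases u) auto
  then have "edge j i" using x T_step by blast
  then show "cyl (u @ [k]) \<subseteq> target j" using cell_subset_target i by blast
qed

lemma inv_word_in:
  "cyl (u @ [k]) \<noteq> {} \<Longrightarrow> t \<in> cell k \<Longrightarrow> inv_word u t \<in> cyl (u @ [k]) \<and> (T ^^ length u) (inv_word u t) = t"
proof (induction u)
  case (Cons j u)
  have ne: "cyl (u @ [k]) \<noteq> {}" "cyl (u @ [k]) \<subseteq> target j" using cyl_Cons_nonempty[of j u k] Cons.prems by auto
  from ne(1) have i: "inv_word u t \<in> cyl (u @ [k])" "(T ^^ length u) (inv_word u t) = t" using Cons by auto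
  then have "inv_word u t \<in> target j" using ne by auto
  then show ?case using i
    by (simp add: inv_branch_in T_inv_branch funpow_Suc_right del: funpow.simps)
qed simp

lemma inv_word_T: "x \<in> cyl (u @ [k]) \<Longrightarrow> inv_word u ((T ^^ length u) x) = x"
  by (induction u arbitrary: x) (auto simp: funpow_Suc_right inv_branch_T simp del: funpow.simps)

lemma inv_word_contract:
  "cyl (u @ [k]) \<noteq> {} \<Longrightarrow> s \<in> cell k \<Longrightarrow> t \<in> cell k \<Longrightarrow>
    \<bar>inv_word u s - inv_word u t\<bar> \<le> (1 / c) ^ length u * \<bar>s - t\<bar>"
proof (induction u)
  case (Cons j u)
  have ne: "cyl (u @ [k]) \<noteq> {}" "cyl (u @ [k]) \<subseteq> target j" using cyl_Cons_nonempty[of j u k] Cons.prems by auto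
  then have "inv_word u s \<in> target j" "inv_word u t \<in> target j"
    using inv_word_in[OF ne(1)] Cons.prems by blast+
  then have "\<bar>inv_word (j # u) s - inv_word (j # u) t\<bar> \<le> \<bar>inv_word u s - inv_word u t\<bar> / c"
    by (simp add: inv_branch_contract)
  also have "\<dots> \<le> ((1 / c) ^ length u * \<bar>s - t\<bar>) / c"
    using Cons.IH[OF ne(1) Cons.prems(2,3)] c_gt_1 by (intro divide_right_mono) auto
  finally show ?case by (simp add: field_simps)
qed simp

lemma inv_word_has_deriv:
  "cyl (u @ [k]) \<noteq> {} \<Longrightarrow> t \<in> cell k \<Longrightarrow>
    (inv_word u has_real_derivative inv_word_deriv u t) (at t) \<and> inv_word_deriv u t \<noteq> 0"
proof (induction u)
  case Nil
  then show ?case by (auto intro!: derivative_eq_intros simp: fun_eq_iff[symmetric] eta_contract_eq)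
next
  case (Cons j u)
  have ne: "cyl (u @ [k]) \<noteq> {}" "cyl (u @ [k]) \<subseteq> target j" using cyl_Cons_nonempty[of j u k] Cons.prems by auto
  then have "inv_word u t \<in> target j" using inv_word_in Cons.prems by blast
  then have "(inv_branch j has_real_derivative inv_deriv j (inv_word u t)) (at (inv_word u t))"
    "inv_deriv j (inv_word u t) \<noteq> 0"
    using inv_branch_deriv inv_deriv_nonzero by auto
  moreover have "(\<lambda>t. inv_branch j (inv_word u t)) = inv_word (j # u)" by auto
  ultimately show ?case
    using Cons ne DERIV_chain2[of "inv_branch j" "inv_deriv j (inv_word u t)" "inv_word u" t] by auto
qed

text \<open>Chain rule: when a letter is put in front of \<open>u\<close>, its inverse branch acts
  on points at most \<open>(1 / c) ^ length u * \<bar>s - t\<bar>\<close> apart, which adds one term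
  to the exponent.\<close>

lemma inv_word_distortion_sum:
  "cyl (u @ [k]) \<noteq> {} \<Longrightarrow> s \<in> cell k \<Longrightarrow> t \<in> cell k \<Longrightarrow>
    \<bar>inv_word_deriv u s\<bar> \<le> exp (\<eta> * (\<Sum>i<length u. (1 / c) ^ i) * \<bar>s - t\<bar>) * \<bar>inv_word_deriv u t\<bar>"
proof (induction u)
  case (Cons j u)
  let ?S = "\<Sum>i<length u. (1 / c) ^ i"
  have ne: "cyl (u @ [k]) \<noteq> {}" "cyl (u @ [k]) \<subseteq> target j" using cyl_Cons_nonempty[of j u k] Cons.prems by auto
  have "\<bar>inv_deriv j (inv_word u s)\<bar>
      \<le> exp (\<eta> * \<bar>inv_word u s - inv_word u t\<bar>) * \<bar>inv_deriv j (inv_word u t)\<bar>"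
    by (rule inv_deriv_distortion) (use inv_word_in[OF ne(1)] Cons.prems ne in blast)+
  also have "\<dots> \<le> exp (\<eta> * ((1 / c) ^ length u * \<bar>s - t\<bar>)) * \<bar>inv_deriv j (inv_word u t)\<bar>"
    using inv_word_contract[OF ne(1) Cons.prems(2,3)] eta_pos by (intro mult_right_mono) auto
  finally have "\<bar>inv_word_deriv (j # u) s\<bar> \<le> (exp (\<eta> * ((1 / c) ^ length u * \<bar>s - t\<bar>)) * \<bar>inv_deriv j (inv_word u t)\<bar>)
      * (exp (\<eta> * ?S * \<bar>s - t\<bar>) * \<bar>inv_word_deriv u t\<bar>)"
    using Cons ne by (simp add: abs_mult) (intro mult_mono, auto)
  also have "\<dots> = exp (\<eta> * ((1 / c) ^ length u * \<bar>s - t\<bar>) + \<eta> * ?S * \<bar>s - t\<bar>) * \<bar>inv_word_deriv (j # u) t\<bar>"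
    by (simp add: exp_add abs_mult)
  also have "\<eta> * ((1 / c) ^ length u * \<bar>s - t\<bar>) + \<eta> * ?S * \<bar>s - t\<bar>
      = \<eta> * (\<Sum>i<length (j # u). (1 / c) ^ i) * \<bar>s - t\<bar>"
    by (simp add: algebra_simps)
  finally show ?case .
qed simp

text \<open>\<open>1 / (1 - 1 / c)\<close> sums the geometric series of contractions and
  \<open>\<theta>\<close> bounds the distance within the final cell, so the constant depends neither
  on the word nor on the cell.\<close>

definition distortion_const :: real where "distortion_const = exp (\<eta> * (1 / (1 - 1 / c)) * \<theta>)"

lemma distortion_const_pos: "0 < distortion_const"
  by (simp add: distortion_const_def)

lemma inv_word_distortion:
  assumes "cyl (u @ [k]) \<noteq> {}" "s \<in> cell k" "t \<in> cell k"
  shows "\<bar>inv_word_deriv u s\<bar> \<le> distortion_const * \<bar>inv_word_deriv u t\<bar>"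
proof -
  have c1: "norm (1 / c) < 1" using c_gt_1 by simp
  have "(\<Sum>i<length u. (1 / c) ^ i) \<le> (\<Sum>i. (1 / c) ^ i)"
    using c1 c_gt_1 by (intro sum_le_suminf summable_geometric) auto
  also have "\<dots> = 1 / (1 - 1 / c)" by (rule suminf_geometric[OF c1])
  finally have "\<eta> * (\<Sum>i<length u. (1 / c) ^ i) * \<bar>s - t\<bar> \<le> \<eta> * (1 / (1 - 1 / c)) * \<theta>"
    using eta_pos cell_dist[OF assms(2,3)] c_gt_1 by (intro mult_mono) (auto intro!: sum_nonneg)
  then have "exp (\<eta> * (\<Sum>i<length u. (1 / c) ^ i) * \<bar>s - t\<bar>) \<le> distortion_const"
    by (simp add: distortion_const_def)
  then show ?thesis
    by (intro order_trans[OF inv_word_distortion_sum[OF assms]] mult_right_mono) auto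
qed

lemma cyl_diam:
  assumes "x \<in> cyl (u @ [k])" "y \<in> cyl (u @ [k])"
  shows "\<bar>x - y\<bar> \<le> (1 / c) ^ length u * \<theta>"
proof -
  have "\<bar>x - y\<bar> \<le> (1 / c) ^ length u * \<bar>(T ^^ length u) x - (T ^^ length u) y\<bar>"
    using inv_word_contract[of u k "(T ^^ length u) x" "(T ^^ length u) y"] inv_word_T assms cyl_last
    by auto
  also have "\<dots> \<le> (1 / c) ^ length u * \<theta>"
    using cell_dist[OF cyl_last[OF assms(1)] cyl_last[OF assms(2)]] c_gt_1 by (intro mult_left_mono) auto
  finally show ?thesis .
qed

end

section \<open>Bounded distortion and density\<close>

text \<open>By change of variables the measure of the image is the integral of
  \<open>\<bar>g'\<bar>\<close> over \<open>S\<close>.\<close>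

lemma measure_image_deriv_bounds:
  fixes g g' :: "real \<Rightarrow> real"
  assumes S: "S \<in> lmeasurable" and gS: "g ` S \<in> lmeasurable" and inj: "inj_on g S"
    and deriv: "\<And>x. x \<in> S \<Longrightarrow> (g has_real_derivative g' x) (at x within S)"
    and bounds: "\<And>x. x \<in> S \<Longrightarrow> L \<le> \<bar>g' x\<bar> \<and> \<bar>g' x\<bar> \<le> U"
  shows "L * measure lebesgue S \<le> measure lebesgue (g ` S)"
    and "measure lebesgue (g ` S) \<le> U * measure lebesgue S"
proof -
  have "(\<lambda>x. 1::real) absolutely_integrable_on g ` S"
    using gS by (simp add: absolutely_integrable_on_const)
  then have *: "(\<lambda>x. \<bar>g' x\<bar> * 1) absolutely_integrable_on S"
      "integral S (\<lambda>x. \<bar>g' x\<bar> * 1) = integral (g ` S) (\<lambda>x. 1)"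
    using has_absolute_integral_change_of_variables_1'[of S g g' "\<lambda>x. 1" "integral (g ` S) (\<lambda>x. 1)"]
      S deriv inj by (auto dest: fmeasurableD)
  then have int: "(\<lambda>x. \<bar>g' x\<bar>) integrable_on S"
    using set_lebesgue_integral_eq_integral(1) by fastforce
  have eq: "measure lebesgue (g ` S) = integral S (\<lambda>x. \<bar>g' x\<bar>)"
    using * gS by (simp add: lmeasure_integral)
  have const: "integral S (\<lambda>x. b) = b * measure lebesgue S" for b :: real
    using integral_mult_right[of S b "\<lambda>x. 1"] S by (simp add: lmeasure_integral)
  show "L * measure lebesgue S \<le> measure lebesgue (g ` S)"
    unfolding eq const[symmetric] using bounds S int by (intro integral_le integrable_on_const) auto
  show "measure lebesgue (g ` S) \<le> U * measure lebesgue S"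
    unfolding eq const[symmetric] using bounds S int by (intro integral_le integrable_on_const) auto
qed

lemma emeasure_scaled_le_UN:
  assumes "countable I" "disjoint_family_on Z I" "\<And>i. i \<in> I \<Longrightarrow> Z i \<in> sets M" "A \<in> sets M"
    and "\<And>i. i \<in> I \<Longrightarrow> e * emeasure M (Z i) \<le> emeasure M (Z i - A)"
  shows "e * emeasure M (\<Union>i\<in>I. Z i) \<le> emeasure M ((\<Union>i\<in>I. Z i) - A)"
proof -
  have "e * emeasure M (\<Union>i\<in>I. Z i) = (\<integral>\<^sup>+ i. e * emeasure M (Z i) \<partial>count_space I)"
    using assms by (subst emeasure_UN_countable) (auto simp: nn_integral_cmult)
  also have "\<dots> \<le> (\<integral>\<^sup>+ i. emeasure M (Z i - A) \<partial>count_space I)"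
    using assms(5) by (intro nn_integral_mono) auto
  also have "\<dots> = emeasure M (\<Union>i\<in>I. Z i - A)"
    using assms by (intro emeasure_UN_countable[symmetric]) (auto simp: disjoint_family_on_def)
  also have "(\<Union>i\<in>I. Z i - A) = (\<Union>i\<in>I. Z i) - A" by auto
  finally show ?thesis .
qed

context surjective_markov_map
begin

lemma cyl_take: "x \<in> cyl w \<Longrightarrow> x \<in> cyl (take l w)"
  by (simp add: in_cyl_iff)

lemma cyl_subset_cell: "\<exists>i. cyl (u @ [k]) \<subseteq> cell i"
  by (cases u) auto

lemma bounded_cell: "bounded (cell j)"
  by (simp add: cell_def)

lemma borel_bounded_lmeasurable: "S \<in> sets borel \<Longrightarrow> bounded S \<Longrightarrow> S \<in> lmeasurable" for S :: "real set"
  by (rule bounded_set_imp_lmeasurable) auto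

lemma cyl_lmeasurable: "B \<in> sets borel \<Longrightarrow> B \<subseteq> cyl (u @ [k]) \<Longrightarrow> B \<in> lmeasurable"
proof -
  assume B: "B \<in> sets borel" "B \<subseteq> cyl (u @ [k])"
  obtain i where "cyl (u @ [k]) \<subseteq> cell i" using cyl_subset_cell by blast
  then have "bounded B" using B(2) bounded_subset[OF bounded_cell[of i]] by blast
  then show ?thesis using B(1) by (rule borel_bounded_lmeasurable[rotated])
qed

lemma inv_word_image:
  assumes "cyl (u @ [k]) \<noteq> {}" "C \<subseteq> cell k"
  shows "inv_word u ` C = cyl (u @ [k]) \<inter> (T ^^ length u) -` C"
proof (intro set_eqI iffI)
  fix x assume "x \<in> inv_word u ` C"
  then show "x \<in> cyl (u @ [k]) \<inter> (T ^^ length u) -` C"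
    using inv_word_in[OF assms(1)] assms(2) by auto
next
  fix x assume "x \<in> cyl (u @ [k]) \<inter> (T ^^ length u) -` C"
  then show "x \<in> inv_word u ` C"
    using inv_word_T[of x u k] by (metis IntE image_eqI vimageE)
qed

text \<open>With the derivative \<open>D\<close> at a reference point, the cylinder has at most
  \<open>distortion_const * D\<close> times the measure of \<open>cell k\<close>, and the pullback
  of \<open>C\<close> at least \<open>D / distortion_const\<close> times that of \<open>C\<close>.
  Their quotient accounts for the square; cross-multiplication avoids division.\<close>

lemma cyl_measure_pos: "cyl (u @ [k]) \<noteq> {} \<Longrightarrow> 0 < measure lborel (cyl (u @ [k]))"
  and cyl_bounded_distortion:
    "cyl (u @ [k]) \<noteq> {} \<Longrightarrow> C \<in> sets borel \<Longrightarrow> C \<subseteq> cell k \<Longrightarrow>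
      measure lborel C * measure lborel (cyl (u @ [k])) \<le>
      distortion_const\<^sup>2 * measure lborel (cell k) * measure lborel (cyl (u @ [k]) \<inter> (T ^^ length u) -` C)"
proof -
  assume ne: "cyl (u @ [k]) \<noteq> {}"
  obtain t where t: "t \<in> cell k" using cell_nonempty by blast
  define D where "D = \<bar>inv_word_deriv u t\<bar>"
  let ?K = distortion_const
  have D: "0 < D" using inv_word_has_deriv[OF ne t] by (simp add: D_def)
  have K: "0 < ?K" by (rule distortion_const_pos)
  have bd: "D / ?K \<le> \<bar>inv_word_deriv u s\<bar>" "\<bar>inv_word_deriv u s\<bar> \<le> ?K * D" if "s \<in> cell k" for s
    using inv_word_distortion[OF ne t that] inv_word_distortion[OF ne that t] K
    by (auto simp: D_def field_simps)
  have inj: "inj_on (inv_word u) (cell k)"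
    using inv_word_in[OF ne] by (intro inj_on_inverseI[of _ "T ^^ length u"]) auto
  have main: "D / ?K * measure lborel C \<le> measure lborel (cyl (u @ [k]) \<inter> (T ^^ length u) -` C)"
    "measure lborel (cyl (u @ [k]) \<inter> (T ^^ length u) -` C) \<le> ?K * D * measure lborel C"
    if C: "C \<in> sets borel" "C \<subseteq> cell k" for C
  proof -
    have b: "cyl (u @ [k]) \<inter> (T ^^ length u) -` C \<in> sets borel"
      using C by (auto intro: Tn_vimage_borel)
    have 1: "C \<in> lmeasurable" using C bounded_subset[OF bounded_cell C(2)] by (intro borel_bounded_lmeasurable)
    have 2: "inv_word u ` C \<in> lmeasurable"
      unfolding inv_word_image[OF ne C(2)] by (rule cyl_lmeasurable[OF b]) auto
    have 3: "(inv_word u has_real_derivative inv_word_deriv u s) (at s within C)" if "s \<in> C" for s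
      using inv_word_has_deriv[OF ne, of s] that C(2) by (auto intro: has_field_derivative_at_within)
    have 4: "D / ?K \<le> \<bar>inv_word_deriv u s\<bar> \<and> \<bar>inv_word_deriv u s\<bar> \<le> ?K * D" if "s \<in> C" for s
      using bd that C(2) by blast
    note * = measure_image_deriv_bounds[OF 1 2 inj_on_subset[OF inj C(2)] 3 4]
    show "D / ?K * measure lborel C \<le> measure lborel (cyl (u @ [k]) \<inter> (T ^^ length u) -` C)"
      "measure lborel (cyl (u @ [k]) \<inter> (T ^^ length u) -` C) \<le> ?K * D * measure lborel C"
      using *[unfolded inv_word_image[OF ne C(2)]] b C(1) by simp_all
  qed
  have cyl_eq: "cyl (u @ [k]) \<inter> (T ^^ length u) -` cell k = cyl (u @ [k])"
    using cyl_last by auto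
  have cell_pos': "0 < measure lborel (cell k)"
    using gap(1)[of k] by (simp add: cell_def)
  have "0 < D / ?K * measure lborel (cell k)"
    using D K cell_pos' by auto
  also have "\<dots> \<le> measure lborel (cyl (u @ [k]))"
    using main(1)[of "cell k"] by (simp add: cyl_eq)
  finally show "0 < measure lborel (cyl (u @ [k]))" .
  assume C: "C \<in> sets borel" "C \<subseteq> cell k"
  have "measure lborel C * measure lborel (cyl (u @ [k])) \<le> measure lborel C * (?K * D * measure lborel (cell k))"
    using main(2)[of "cell k"] by (intro mult_left_mono) (auto simp: cyl_eq)
  also have "\<dots> = ?K\<^sup>2 * measure lborel (cell k) * (D / ?K * measure lborel C)"
    using K by (simp add: power2_eq_square)
  also have "\<dots> \<le> ?K\<^sup>2 * measure lborel (cell k) * measure lborel (cyl (u @ [k]) \<inter> (T ^^ length u) -` C)"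
    using main(1)[OF C] by (intro mult_left_mono) auto
  finally show "measure lborel C * measure lborel (cyl (u @ [k])) \<le>
      ?K\<^sup>2 * measure lborel (cell k) * measure lborel (cyl (u @ [k]) \<inter> (T ^^ length u) -` C)" .
qed

text \<open>The minimal words whose cylinder ends in \<open>cell k\<close> and lies in an open set slightly larger
  than \<open>A\<close> give a disjoint cover of \<open>A\<close>, so one of their cylinders is almost filled by \<open>A\<close>. This
  takes the place of the Lebesgue density theorem.\<close>

lemma ex_cyl_almost_filled:
  assumes A: "A \<in> sets borel" "A \<subseteq> cell k" "\<not> negligible A"
    and return: "AE x in lborel. x \<in> A \<longrightarrow> (\<forall>N. \<exists>n\<ge>N. n \<in> P \<and> (T ^^ n) x \<in> cell k)"
    and e: "0 < e"
  shows "\<exists>u. length u \<in> P \<and>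
    emeasure lborel (cyl (u @ [k]) - A) < ennreal e * emeasure lborel (cyl (u @ [k]))"
proof (rule ccontr)
  assume neg: "\<not> ?thesis"
  have fin: "emeasure lborel A < \<infinity>"
    using emeasure_mono[of A "cell k" lborel] A cell_finite[of k] by (simp add: order_le_less_trans)
  define m where "m = measure lborel A"
  have em: "emeasure lborel A = ennreal m"
    using fin by (simp add: m_def emeasure_eq_ennreal_measure)
  then have m: "0 < m"
    using A(3) negligible_borel_iff[OF A(1)] by (simp add: ennreal_eq_0_iff not_le)
  have "A \<in> sets lebesgue" using A(1) by simp
  \<comment> \<open>If each candidate cylinder had a fraction of at least \<open>e\<close> outside
    \<open>A\<close>, their union, which covers almost all of \<open>A\<close> inside
    \<open>U\<close>, would force \<open>U - A\<close> to have measure at least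
    \<open>e * m\<close>.\<close>
  then obtain U where U: "open U" "A \<subseteq> U" "emeasure lebesgue (U - A) < ennreal (e * m)"
    by (rule sets_lebesgue_outer_open[OF _ mult_pos_pos[OF e m]])
  define W0 where "W0 = {u @ [k] | u. length u \<in> P \<and> cyl (u @ [k]) \<subseteq> U}"
  \<comment> \<open>Cylinders that share a point belong to words one of which is a prefix of the
    other, so forbidding proper prefixes in \<open>W0\<close> makes them disjoint.\<close>
  define W where "W = {w \<in> W0. \<forall>n<length w. take n w \<notin> W0}"
  have disj: "disjoint_family_on cyl W"
  proof (rule ccontr)
    assume "\<not> ?thesis"
    then obtain w w' x where w: "w \<in> W" "w' \<in> W" "w \<noteq> w'" "x \<in> cyl w" "x \<in> cyl w'"
      unfolding disjoint_family_on_def by blast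
    have False if "w \<in> W" "w' \<in> W" "w \<noteq> w'" "x \<in> cyl w" "x \<in> cyl w'" "length w \<le> length w'" for w w'
    proof -
      have t: "take (length w) w' = w" using cyl_take_unique that by blast
      then have "length w < length w'" using that by (metis le_neq_implies_less take_all_iff order_refl)
      then show False using that t unfolding W_def by (metis (mono_tags, lifting) mem_Collect_eq)
    qed
    from this[OF w] this[OF w(2,1) w(3)[symmetric] w(5,4)] show False by linarith
  qed
  define V where "V = (\<Union>w\<in>W. cyl w)"
  have VU: "V \<subseteq> U" unfolding V_def W_def W0_def by blast
  have V: "V \<in> sets borel"
    unfolding V_def by (intro sets.countable_UN'') auto
  have AV: "AE x in lborel. x \<in> A \<longrightarrow> x \<in> V"
    using return AE_regular
  proof eventually_elim
    case (elim x)
    show ?case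
    proof
      assume x: "x \<in> A"
      then obtain r where r: "0 < r" "ball x r \<subseteq> U" using U by (meson openE subsetD)
      have "(\<lambda>n. (1 / c) ^ n * \<theta>) \<longlonglongrightarrow> 0 * \<theta>"
        using c_gt_1 by (intro tendsto_mult LIMSEQ_realpow_zero) auto
      then have "\<forall>\<^sub>F n in sequentially. (1 / c) ^ n * \<theta> < r"
        using r by (auto intro: order_tendstoD)
      then obtain N where N: "\<And>n. n \<ge> N \<Longrightarrow> (1 / c) ^ n * \<theta> < r"
        by (auto simp: eventually_sequentially)
      \<comment> \<open>The return must be late enough for the cylinder around \<open>x\<close> to
        fit into the ball inside \<open>U\<close>.\<close>
      obtain n where n: "n \<ge> N" "n \<in> P" "(T ^^ n) x \<in> cell k" using elim x by blast
      obtain u where u: "length u = n" "x \<in> cyl (u @ [k])" using regular_word elim n by blast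
      have "cyl (u @ [k]) \<subseteq> U"
      proof
        fix y assume "y \<in> cyl (u @ [k])"
        then have "\<bar>x - y\<bar> < r" using cyl_diam[OF u(2)] N n u by force
        then show "y \<in> U" using r by (auto simp: dist_real_def)
      qed
      then have ex: "u @ [k] \<in> W0" "take (length (u @ [k])) (u @ [k]) \<in> W0"
        using u n by (auto simp: W0_def)
      define l where "l = (LEAST l. take l (u @ [k]) \<in> W0)"
      have l: "take l (u @ [k]) \<in> W0" unfolding l_def
        by (rule LeastI[where P = "\<lambda>l. take l (u @ [k]) \<in> W0", OF ex(2)])
      have "take l (u @ [k]) \<in> W"
        unfolding W_def
      proof (intro CollectI conjI l allI impI)
        fix n assume "n < length (take l (u @ [k]))"
        then have "n < l" by (simp only: length_take min_less_iff_conj)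
        then show "take n (take l (u @ [k])) \<notin> W0"
          using not_less_Least[of n "\<lambda>l. take l (u @ [k]) \<in> W0", folded l_def]
          by (simp only: take_take min_absorb1 less_imp_le not_False_eq_True simp_thms)
      qed
      moreover have "x \<in> cyl (take l (u @ [k]))"
        by (rule cyl_take[OF u(2)])
      ultimately show "x \<in> V" unfolding V_def by blast
    qed
  qed
  have "ennreal (e * m) = ennreal e * emeasure lborel A"
    using e m by (simp add: em ennreal_mult)
  also have "\<dots> \<le> ennreal e * emeasure lborel V"
    using AV V A by (intro mult_left_mono emeasure_mono_AE) auto
  also have "\<dots> \<le> emeasure lborel (V - A)"
    unfolding V_def
  proof (rule emeasure_scaled_le_UN[OF _ disj])
    fix w assume "w \<in> W"
    then obtain u where "w = u @ [k]" "length u \<in> P" unfolding W_def W0_def by auto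
    then show "ennreal e * emeasure lborel (cyl w) \<le> emeasure lborel (cyl w - A)"
      using neg by (auto simp: not_less)
  qed (use A in auto)
  also have "\<dots> \<le> emeasure lborel (U - A)"
    using VU A U by (intro emeasure_mono) auto
  also have "\<dots> < ennreal (e * m)"
    using U A by (simp add: borel_open)
  finally show False by simp
qed

text \<open>The order of quantifiers matters: \<open>n\<close> depends on \<open>A\<close> only and
  serves every \<open>B\<close>. The cylinder almost filled by \<open>A\<close> is stretched over
  \<open>cell k\<close>, and bounded distortion keeps the missing part small.\<close>

lemma ex_time_almost_full:
  assumes A: "A \<in> sets borel" "\<not> negligible (A \<inter> cell k)"
    and return: "AE x in lborel. x \<in> A \<inter> cell k \<longrightarrow> (\<forall>N. \<exists>n\<ge>N. n \<in> P \<and> (T ^^ n) x \<in> cell k)"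
    and e: "0 < e"
  shows "\<exists>n\<in>P. \<forall>B\<in>sets borel. A =\<^sub>m (T ^^ n) -` B \<longrightarrow> measure lborel (cell k - B) < e"
proof -
  let ?M = "distortion_const\<^sup>2 * measure lborel (cell k)"
  have M: "0 < ?M" using distortion_const_pos gap(1)[of k] by (simp add: cell_def)
  \<comment> \<open>A fraction \<open>d\<close> missing from the cylinder becomes a part of measure
    at most \<open>d * ?M\<close> missing from \<open>cell k\<close>.\<close>
  define d where "d = e / ?M"
  have d: "0 < d" using e M by (simp add: d_def)
  from ex_cyl_almost_filled[OF _ _ A(2) return d] A obtain u where u: "length u \<in> P"
    "emeasure lborel (cyl (u @ [k]) - A \<inter> cell k) < ennreal d * emeasure lborel (cyl (u @ [k]))"
    by auto
  let ?Z = "cyl (u @ [k])"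
  have ne: "?Z \<noteq> {}" using u by (auto simp del: cyl.simps)
  have Zfin: "emeasure lborel ?Z < \<infinity>"
    using cyl_lmeasurable[of ?Z u k] by (auto simp: fmeasurable_def)
  then have Z: "emeasure lborel ?Z = ennreal (measure lborel ?Z)"
    by (simp add: emeasure_eq_ennreal_measure)
  have "measure lborel (cell k - B) < e" if B: "B \<in> sets borel" "A =\<^sub>m (T ^^ length u) -` B" for B
  proof -
    let ?C = "cell k - B"
    have CB: "?C \<in> sets borel" using B by auto
    let ?X = "?Z \<inter> (T ^^ length u) -` ?C"
    have X: "?X \<in> sets borel" using Tn_vimage_borel[OF CB] by auto
    have "AE x in lborel. x \<in> ?X \<longrightarrow> x \<in> ?Z - A \<inter> cell k"
      using B(2) unfolding eq_mod_def by eventually_elim auto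
    then have "emeasure lborel ?X \<le> emeasure lborel (?Z - A \<inter> cell k)"
      using A by (intro emeasure_mono_AE) auto
    also note u(2)
    finally have "emeasure lborel ?X < ennreal (d * measure lborel ?Z)"
      using d Z by (simp add: ennreal_mult)
    moreover from this have "emeasure lborel ?X \<noteq> top"
      by auto
    ultimately have "measure lborel ?X < d * measure lborel ?Z"
      by (simp add: emeasure_eq_ennreal_measure ennreal_less_iff)
    then have "?M * measure lborel ?X < ?M * (d * measure lborel ?Z)"
      using M by (rule mult_strict_left_mono)
    then have "measure lborel ?C * measure lborel ?Z < ?M * (d * measure lborel ?Z)"
      using cyl_bounded_distortion[OF ne CB] by force
    also have "\<dots> = e * measure lborel ?Z"
      unfolding d_def using M
      by (metis less_irrefl mult.assoc nonzero_mult_div_cancel_left times_divide_eq_right)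
    finally show ?thesis using cyl_measure_pos[OF ne] by simp
  qed
  then show ?thesis using u(1) by blast
qed

end

section \<open>Recurrence in a conservative invariant region\<close>

lemma ex_AE_not_negligible:
  assumes "\<not> negligible S" "AE x in lborel. P x"
  obtains x where "x \<in> S" "P x"
proof -
  have "negligible {x. \<not> P x}" using assms(2) by (simp add: AE_lborel_iff_negligible)
  then have "\<not> S \<subseteq> {x. \<not> P x}" using assms(1) negligible_subset by blast
  then show thesis using that by blast
qed

text \<open>Let \<open>e\<close> be the least positive difference, attained by \<open>q\<close> and
  \<open>q + e\<close>. If \<open>n = t * e + s\<close> with \<open>t > 0\<close>, then
  \<open>n + t * q\<close> and \<open>t * (q + e)\<close> lie in \<open>R\<close> and differ by the
  remainder \<open>s\<close>, which must vanish by minimality. So \<open>e\<close> divides all of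
  \<open>R\<close> and equals the gcd.\<close>

lemma Gcd_difference:
  fixes R :: "nat set"
  assumes pos: "\<And>n. n \<in> R \<Longrightarrow> 0 < n" and add: "\<And>m n. m \<in> R \<Longrightarrow> n \<in> R \<Longrightarrow> m + n \<in> R" and "r \<in> R"
  shows "\<exists>q\<in>R. q + Gcd R \<in> R"
proof -
  define P where "P e \<longleftrightarrow> 0 < e \<and> (\<exists>q\<in>R. q + e \<in> R)" for e
  have P_R: "P n" if "n \<in> R" for n using that pos add unfolding P_def by blast
  define e where "e = (LEAST e. P e)"
  have "P e" unfolding e_def by (rule LeastI[of P, OF P_R[OF \<open>r \<in> R\<close>]])
  then obtain q where q: "0 < e" "q \<in> R" "q + e \<in> R" unfolding P_def by blast
  have mult: "t * n \<in> R" if "0 < t" "n \<in> R" for t n :: nat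
    using that(1)
  proof (induction t rule: nat_induct_non_zero)
    case (Suc t) then show ?case using add that(2) by simp
  qed (use that in simp)
  have "e dvd n" if n: "n \<in> R" for n
  proof (rule ccontr)
    assume nd: "\<not> e dvd n"
    define t where "t = n div e"
    define s where "s = n mod e"
    have s: "0 < s" "s < e" "n = t * e + s" using nd q(1) by (auto simp: s_def t_def dvd_eq_mod_eq_0)
    have "P s"
    \<comment> \<open>Multiples stay in \<open>R\<close> only for positive factors. For
      \<open>t = 0\<close> the elements \<open>n\<close> and \<open>n + n\<close> have the
      difference \<open>n = s\<close>.\<close>
    proof (cases "t = 0")
      case True
      then show ?thesis using P_R[OF n] s by simp
    next
      case False
      then have "t * (q + e) \<in> R" "n + t * q \<in> R" using mult q n add by auto
      moreover have "n + t * q = t * (q + e) + s" using s(3) by (simp add: algebra_simps)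
      ultimately show ?thesis using s(1) unfolding P_def by auto
    qed
    then show False using s(2) not_less_Least unfolding e_def by blast
  qed
  then have "e dvd Gcd R" by (intro Gcd_greatest) auto
  moreover have "Gcd R dvd e"
    using Gcd_dvd[OF q(2)] Gcd_dvd[OF q(3)] by (simp add: dvd_add_right_iff)
  ultimately have "e = Gcd R" by (rule dvd_antisym)
  then show ?thesis using q by auto
qed

context surjective_markov_map
begin

lemma cell_not_negligible: "\<not> negligible (cell j)"
  by (rule open_not_negligible[OF open_cell cell_nonempty])

lemma cyl_not_negligible:
  assumes "cyl (u @ [k]) \<noteq> {}" shows "\<not> negligible (cyl (u @ [k]))"
proof
  assume "negligible (cyl (u @ [k]))"
  then have "emeasure lborel (cyl (u @ [k])) = 0" by (simp add: negligible_borel_iff)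
  then have "measure lborel (cyl (u @ [k])) = 0" by (simp add: measure_def)
  then show False using cyl_measure_pos[OF assms] by simp
qed

lemma path_covers: "(edge ^^ n) j k \<Longrightarrow> cell k \<subseteq> (T ^^ n) ` cell j"
proof
  fix y assume "(edge ^^ n) j k" "y \<in> cell k"
  then obtain u where u: "length u = n" "cyl (u @ [k]) \<noteq> {}" "cyl (u @ [k]) \<subseteq> cell j"
    using path_word by blast
  then have "inv_word u y \<in> cell j" "(T ^^ n) (inv_word u y) = y"
    using inv_word_in[OF u(2) \<open>y \<in> cell k\<close>] by auto
  then show "y \<in> (T ^^ n) ` cell j" by (metis image_eqI)
qed

text \<open>Fullness travels along paths: the exceptional null set has a null image, and the image
  of \<open>cell j\<close> covers \<open>cell k\<close>.\<close>

lemma full_image: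
  assumes "(edge ^^ n) j k" "cell j \<subseteq>\<^sub>m (T ^^ n) -` B"
  shows "cell k \<subseteq>\<^sub>m B"
proof -
  have "negligible (cell j - (T ^^ n) -` B)"
    using assms(2) by (simp add: subset_mod_def AE_lborel_iff_negligible set_diff_eq)
  then have "negligible ((T ^^ n) ` (cell j - (T ^^ n) -` B))" by (rule negligible_Tn_image)
  moreover have "{x. \<not> (x \<in> cell k \<longrightarrow> x \<in> B)} \<subseteq> (T ^^ n) ` (cell j - (T ^^ n) -` B)"
    using path_covers[OF assms(1)] by blast
  ultimately show ?thesis
    unfolding subset_mod_def AE_lborel_iff_negligible by (rule negligible_subset)
qed

end

text \<open>Isolates the properties through which \<open>I_C T\<close> enters. Invariance is
  pointwise, as it is for invariant hulls.\<close>

locale conservative_region = surjective_markov_map +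
  fixes X :: "real set"
  assumes X_borel: "X \<in> sets borel"
    and X_inv: "T x \<in> X \<longleftrightarrow> x \<in> X"
    and X_conservative: "wandering T W \<Longrightarrow> W \<subseteq> X \<Longrightarrow> negligible W"
begin

lemma X_inv_Tn: "(T ^^ n) x \<in> X \<longleftrightarrow> x \<in> X"
  by (induction n) (auto simp: X_inv)

text \<open>Poincare recurrence: the points of the cell in \<open>X\<close> that never return form a
  wandering set, which is null together with its preimages. A point with finitely many visits would
  be in that set at its last visit.\<close>

lemma recurrence: "AE x in lborel. x \<in> X \<inter> cell k \<longrightarrow> (\<forall>N. \<exists>n\<ge>N. (T ^^ n) x \<in> cell k)"
proof -
  define W where "W = X \<inter> cell k - (\<Union>n. (T ^^ Suc n) -` cell k)"
  have no_return: "(T ^^ j) x \<notin> W" if "(T ^^ i) x \<in> W" "i < j" for i j x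
  proof -
    obtain n where n: "j = i + Suc n" using less_imp_Suc_add[OF \<open>i < j\<close>] by auto
    have "(T ^^ j) x = (T ^^ Suc n) ((T ^^ i) x)"
      by (simp only: n add.commute[of i] funpow_add comp_apply)
    moreover have "(T ^^ i) x \<notin> (\<Union>n. (T ^^ Suc n) -` cell k)"
      using that(1) unfolding W_def by (simp only: Diff_iff not_False_eq_True)
    then have "(T ^^ Suc n) ((T ^^ i) x) \<notin> cell k" by (simp only: UN_iff vimage_eq) blast
    ultimately show ?thesis unfolding W_def by (simp only: Diff_iff Int_iff) blast
  qed
  have "W \<in> sets borel"
    unfolding W_def using X_borel by (intro sets.Diff sets.Int sets.countable_UN'' Tn_vimage_borel) auto
  moreover have "(T ^^ i) -` W \<inter> (T ^^ j) -` W = {}" if "i \<noteq> j" for i j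
    using no_return[of i _ j] no_return[of j _ i] that by (cases i j rule: linorder_cases) auto
  ultimately have "wandering T W"
    unfolding wandering_def by (simp add: eq_mod_def)
  moreover have "W \<subseteq> X" unfolding W_def by (rule order_trans[OF Diff_subset Int_lower1])
  ultimately have "AE x in lborel. x \<notin> W"
    unfolding negligible_iff_AE[symmetric] by (rule X_conservative)
  then have "AE x in lborel. \<forall>n. (T ^^ n) x \<notin> W"
    unfolding AE_all_countable by (intro allI AE_Tn)
  then show ?thesis
  proof eventually_elim
    case (elim x)
    show ?case
    proof (rule impI, rule ccontr)
      assume x: "x \<in> X \<inter> cell k" and neg: "\<not> (\<forall>N. \<exists>n\<ge>N. (T ^^ n) x \<in> cell k)"
      define S where "S = {n. (T ^^ n) x \<in> cell k}"
      have fin: "finite S"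
        using neg unfolding S_def finite_nat_set_iff_bounded by (auto simp: not_le[symmetric])
      have "0 \<in> S" using x by (simp add: S_def)
      then have M: "Max S \<in> S" using fin by (intro Max_in) auto
      have "(T ^^ Suc n) ((T ^^ Max S) x) \<notin> cell k" for n
      proof
        assume "(T ^^ Suc n) ((T ^^ Max S) x) \<in> cell k"
        then have "Suc n + Max S \<in> S" unfolding S_def by (simp only: mem_Collect_eq funpow_add comp_apply)
        from Max_ge[OF fin this] show False by simp
      qed
      then have "(T ^^ Max S) x \<in> W"
        using M x X_inv_Tn[of "Max S" x] unfolding W_def S_def
        by (simp only: mem_Collect_eq Diff_iff Int_iff UN_iff vimage_eq) blast
      then show False using elim by (simp only: not_True_eq_False)
    qed
  qed
qed

text \<open>Recording that a return time is the length of a closed path makes it divisible by the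
  period later on.\<close>

lemma recurrence_path:
  "AE x in lborel. x \<in> X \<inter> cell k \<longrightarrow> (\<forall>N. \<exists>n\<ge>N. (edge ^^ n) k k \<and> (T ^^ n) x \<in> cell k)"
  using recurrence[of k] AE_regular
proof eventually_elim
  case (elim x)
  then show ?case using Tn_steps by blast
qed

lemma ex_time_almost_full_return:
  assumes A: "A \<in> sets borel" "A \<subseteq>\<^sub>m X" "\<not> negligible (A \<inter> cell k)" and e: "0 < e"
  obtains n where "(edge ^^ n) k k"
    "\<And>B. B \<in> sets borel \<Longrightarrow> A =\<^sub>m (T ^^ n) -` B \<Longrightarrow> measure lborel (cell k - B) < e"
proof -
  have "AE x in lborel. x \<in> A \<inter> cell k \<longrightarrow> (\<forall>N. \<exists>n\<ge>N. n \<in> {n. (edge ^^ n) k k} \<and> (T ^^ n) x \<in> cell k)"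
    using A(2)[unfolded subset_mod_def] recurrence_path[of k]
  proof eventually_elim
    case (elim x)
    then show ?case by blast
  qed
  from ex_time_almost_full[OF A(1,3) this e] show thesis using that by blast
qed

text \<open>Invariance is required only at lengths of closed paths, so that sets invariant under a
  power of \<open>T\<close> are covered too. Then \<open>B\<close> may be \<open>A\<close> itself,
  whose missing part is smaller than every positive \<open>e\<close>.\<close>

lemma full_cell:
  assumes A: "A \<in> sets borel" "A \<subseteq>\<^sub>m X" "\<not> negligible (A \<inter> cell k)"
    and inv: "\<And>n. (edge ^^ n) k k \<Longrightarrow> A =\<^sub>m (T ^^ n) -` A"
  shows "cell k \<subseteq>\<^sub>m A"
proof -
  have *: "measure lborel (cell k - A) < e" if e: "0 < e" for e
  proof -
    obtain n where "(edge ^^ n) k k"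
      "\<And>B. B \<in> sets borel \<Longrightarrow> A =\<^sub>m (T ^^ n) -` B \<Longrightarrow> measure lborel (cell k - B) < e"
      using ex_time_almost_full_return[OF A e] by blast
    then show ?thesis using inv A(1) by blast
  qed
  have "measure lborel (cell k - A) = 0"
    using *[of "measure lborel (cell k - A)"] measure_nonneg[of lborel "cell k - A"] by linarith
  moreover have "emeasure lborel (cell k - A) < \<infinity>"
    using emeasure_mono[of "cell k - A" "cell k" lborel] A cell_finite[of k]
    by (auto simp: order_le_less_trans)
  ultimately have "emeasure lborel (cell k - A) = 0"
    by (simp add: emeasure_eq_ennreal_measure)
  then have "negligible (cell k - A)"
    using A(1) by (subst negligible_borel_iff) auto
  then show ?thesis
    by (simp add: subset_mod_def AE_lborel_iff_negligible set_diff_eq)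
qed

text \<open>By \<open>K_full\<close> and \<open>AE_X_K\<close>, the region \<open>X\<close> is the
  union of these cells modulo null sets.\<close>

definition K :: "int set" where "K = {k. \<not> negligible (X \<inter> cell k)}"

lemma K_full: "k \<in> K \<Longrightarrow> cell k \<subseteq>\<^sub>m X"
  using X_borel by (intro full_cell) (auto simp: K_def subset_mod_def eq_mod_def X_inv_Tn)

lemma in_K_if_full: "cell k \<subseteq>\<^sub>m X \<Longrightarrow> k \<in> K"
proof (unfold K_def, intro CollectI notI)
  assume "cell k \<subseteq>\<^sub>m X" "negligible (X \<inter> cell k)"
  then have "AE x in lborel. x \<notin> cell k"
    unfolding subset_mod_def negligible_iff_AE by eventually_elim auto
  then show False using cell_not_negligible unfolding negligible_iff_AE by blast
qed

lemma AE_X_K: "AE x in lborel. x \<in> X \<longrightarrow> (\<forall>k. x \<in> cell k \<longrightarrow> k \<in> K)"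
proof -
  have "AE x in lborel. x \<in> X \<longrightarrow> x \<in> cell k \<longrightarrow> k \<in> K" for k
  proof (cases "k \<in> K")
    case False
    then have "AE x in lborel. x \<notin> X \<inter> cell k" by (simp add: K_def negligible_iff_AE)
    then show ?thesis by eventually_elim auto
  qed simp
  then have "AE x in lborel. \<forall>k. x \<in> X \<longrightarrow> x \<in> cell k \<longrightarrow> k \<in> K"
    by (subst AE_all_countable) blast
  then show ?thesis by eventually_elim auto
qed

lemma K_forward: "k \<in> K \<Longrightarrow> (edge ^^ n) k l \<Longrightarrow> l \<in> K"
  using full_image[of n k l X] K_full[of k] in_K_if_full[of l]
  by (simp add: subset_mod_def X_inv_Tn)

text \<open>If \<open>cell k\<close> missed \<open>X\<close>, its orbits would stay in the
  complement, and by \<open>full_image\<close> the cell \<open>l\<close> would miss \<open>X\<close>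
  as well.\<close>

lemma K_backward:
  assumes "l \<in> K" "(edge ^^ n) k l" shows "k \<in> K"
proof (rule ccontr)
  assume "k \<notin> K"
  then have "AE x in lborel. x \<notin> X \<inter> cell k" by (simp add: K_def negligible_iff_AE)
  then have "cell k \<subseteq>\<^sub>m (T ^^ n) -` (- X)"
    unfolding subset_mod_def by eventually_elim (auto simp: X_inv_Tn)
  then have "AE x in lborel. x \<in> cell l \<longrightarrow> x \<notin> X"
    using full_image[OF assms(2), of "- X"] by (simp add: subset_mod_def)
  then have "negligible (X \<inter> cell l)"
    unfolding negligible_iff_AE by eventually_elim auto
  then show False using assms(1) by (simp add: K_def)
qed

text \<open>A typical point of the cylinder of the path is in \<open>cell l\<close> at time
  \<open>n\<close> and by recurrence in \<open>cell k\<close> at some later or equal time; its orbit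
  in between is a path back.\<close>

lemma reach_sym:
  assumes "k \<in> K" "(edge ^^ n) k l" shows "\<exists>m. (edge ^^ m) l k"
proof -
  from path_word[OF assms(2)] obtain u where
    u: "length u = n" "cyl (u @ [l]) \<noteq> {}" "cyl (u @ [l]) \<subseteq> cell k" by blast
  have "AE x in lborel. regular x \<and> (x \<in> cell k \<longrightarrow> (\<exists>m\<ge>n. (T ^^ m) x \<in> cell k))"
    using recurrence[of k] AE_regular K_full[OF assms(1), unfolded subset_mod_def]
    by eventually_elim auto
  then obtain x where x: "x \<in> cyl (u @ [l])" "regular x" "x \<in> cell k \<longrightarrow> (\<exists>m\<ge>n. (T ^^ m) x \<in> cell k)"
    by (rule ex_AE_not_negligible[OF cyl_not_negligible[OF u(2)]]) blast
  then obtain m where m: "m \<ge> n" "(T ^^ m) x \<in> cell k" using u(3) by blast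
  have "(T ^^ m) x = (T ^^ (m - n)) ((T ^^ n) x)"
    using m(1) by (metis comp_apply funpow_add le_add_diff_inverse2)
  then have "(edge ^^ (m - n)) l k"
    using Tn_steps[OF regular_Tn[OF x(2)], of n l "m - n" k] cyl_last[OF x(1)] u(1) m(2) by simp
  then show ?thesis ..
qed

section \<open>Reachability, periods and cyclic classes\<close>

definition reach :: "int \<Rightarrow> int \<Rightarrow> bool" where "reach k l \<longleftrightarrow> (\<exists>n. (edge ^^ n) k l)"

lemma path_trans: "(edge ^^ m) j k \<Longrightarrow> (edge ^^ n) k l \<Longrightarrow> (edge ^^ (m + n)) j l"
  by (auto simp: relpowp_add)

lemma reach_refl [simp]: "reach k k"
  unfolding reach_def by (intro exI[of _ 0]) simp

lemma reach_trans: "reach j k \<Longrightarrow> reach k l \<Longrightarrow> reach j l"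
  unfolding reach_def using path_trans by blast

lemma reach_symmetric: "k \<in> K \<Longrightarrow> reach k l \<Longrightarrow> reach l k"
  unfolding reach_def using reach_sym by blast

lemma K_reach: "k \<in> K \<Longrightarrow> reach k l \<Longrightarrow> l \<in> K"
  unfolding reach_def using K_forward by blast

text \<open>Graph version of \<open>period\<close>; they agree by
  \<open>period_eq_per\<close>.\<close>

definition per :: "int \<Rightarrow> nat" where "per k = Gcd {n. 1 \<le> n \<and> (edge ^^ n) k k}"

lemma per_dvd: "(edge ^^ n) k k \<Longrightarrow> per k dvd n"
  unfolding per_def by (cases "n = 0") (auto intro: Gcd_dvd)

lemma ex_cycle: "k \<in> K \<Longrightarrow> \<exists>n\<ge>1. (edge ^^ n) k k"
proof -
  assume k: "k \<in> K"
  obtain l where l: "edge k l" using ex_edge by blast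
  then obtain m where "(edge ^^ m) l k" using reach_sym[OF k, of 1 l] by auto
  then have "(edge ^^ Suc m) k k" using l by (rule relpowp_Suc_I2[rotated])
  then show ?thesis by (intro exI[of _ "Suc m"]) auto
qed

lemma per_pos: "k \<in> K \<Longrightarrow> 0 < per k"
proof -
  assume "k \<in> K"
  then obtain n where "n \<ge> 1" "(edge ^^ n) k k" using ex_cycle by blast
  then show ?thesis using per_dvd[of n k] by (intro gr0I) auto
qed

lemma ex_consecutive_cycles:
  assumes "k \<in> K" obtains q where "(edge ^^ q) k k" "(edge ^^ (q + per k)) k k"
proof -
  obtain r where r: "r \<in> {n. 1 \<le> n \<and> (edge ^^ n) k k}" using ex_cycle[OF assms] by blast
  have "\<exists>q\<in>{n. 1 \<le> n \<and> (edge ^^ n) k k}. q + per k \<in> {n. 1 \<le> n \<and> (edge ^^ n) k k}"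
    unfolding per_def by (rule Gcd_difference[OF _ _ r]) (auto intro: path_trans)
  then show thesis using that by blast
qed

text \<open>A loop at \<open>l\<close> can be inserted into a closed path from \<open>k\<close>
  through \<open>l\<close>; the lengths with and without it are both multiples of
  \<open>per k\<close>.\<close>

lemma per_dvd_reach:
  assumes "k \<in> K" "reach k l" shows "per k dvd per l"
proof -
  obtain m n where m: "(edge ^^ m) k l" and n: "(edge ^^ n) l k"
    using assms reach_symmetric[OF assms] unfolding reach_def by blast
  have "per k dvd i" if "(edge ^^ i) l l" for i
  proof -
    have "per k dvd m + n" using per_dvd[OF path_trans[OF m n]] .
    moreover have "per k dvd m + (i + n)" using per_dvd[OF path_trans[OF m path_trans[OF that n]]] .
    ultimately show ?thesis by (metis add.assoc add.commute dvd_add_left_iff)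
  qed
  then show ?thesis unfolding per_def[of l] by (intro Gcd_greatest) auto
qed

lemma per_reach: "k \<in> K \<Longrightarrow> reach k l \<Longrightarrow> per l = per k"
  using per_dvd_reach[of k l] per_dvd_reach[of l k] K_reach reach_symmetric
  by (metis dvd_antisym)

text \<open>Indexed by all naturals, so that \<open>i + n\<close> needs no reduction; congruent
  indices give the same class.\<close>

definition cyclic_class :: "int \<Rightarrow> nat \<Rightarrow> int set" where
  "cyclic_class k i = {l. \<exists>n. (edge ^^ n) k l \<and> [n = i] (mod per k)}"

lemma cyclic_class_reach: "l \<in> cyclic_class k i \<Longrightarrow> reach k l"
  by (auto simp: cyclic_class_def reach_def)

lemma cyclic_class_cong: "[i = j] (mod per k) \<Longrightarrow> cyclic_class k i = cyclic_class k j"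
  unfolding cyclic_class_def by (metis cong_sym cong_trans)

lemma cyclic_class_step: "l \<in> cyclic_class k i \<Longrightarrow> (edge ^^ n) l p \<Longrightarrow> p \<in> cyclic_class k (i + n)"
proof -
  assume "l \<in> cyclic_class k i" and lp: "(edge ^^ n) l p"
  then obtain m where "(edge ^^ m) k l" "[m = i] (mod per k)" by (auto simp: cyclic_class_def)
  then have "(edge ^^ (m + n)) k p" "[m + n = i + n] (mod per k)"
    using path_trans lp by (auto intro: cong_add)
  then show ?thesis by (auto simp: cyclic_class_def)
qed

text \<open>Two paths from \<open>k\<close> to \<open>l\<close>, closed up by the same path back,
  become cycles, so their lengths are congruent.\<close>

lemma cyclic_class_disjoint:
  assumes "k \<in> K" "l \<in> cyclic_class k i" "l \<in> cyclic_class k j"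
  shows "[i = j] (mod per k)"
proof -
  obtain m n where mn: "(edge ^^ m) k l" "[m = i] (mod per k)" "(edge ^^ n) k l" "[n = j] (mod per k)"
    using assms by (auto simp: cyclic_class_def)
  obtain r where r: "(edge ^^ r) l k" using reach_sym[OF assms(1) mn(1)] by blast
  have "[m + r = 0] (mod per k)" "[n + r = 0] (mod per k)"
    using per_dvd path_trans mn r by (auto simp: cong_0_iff)
  then have "[m + r = n + r] (mod per k)" by (blast intro: cong_sym cong_trans)
  then have "[m = n] (mod per k)" by (simp only: cong_add_rcancel_nat)
  then show ?thesis using mn(2,4) by (blast intro: cong_sym cong_trans)
qed

text \<open>The direction from \<open>p\<close> to \<open>l\<close> turns the inclusion for
  preimages into an equality: \<open>l\<close> lies in \<open>K\<close>, is reached from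
  \<open>k\<close> by symmetry and so is in some class, whose index is determined modulo the
  period.\<close>

lemma cyclic_class_step_iff:
  assumes "k \<in> K" "(edge ^^ n) l p"
  shows "p \<in> cyclic_class k (i + n) \<longleftrightarrow> l \<in> cyclic_class k i"
proof
  assume p: "p \<in> cyclic_class k (i + n)"
  then have kp: "reach k p" and pK: "p \<in> K" using cyclic_class_reach K_reach assms(1) by auto
  then have lK: "l \<in> K" using K_backward assms(2) by blast
  have "reach l p" using assms(2) reach_def by blast
  then have "reach k l" using reach_trans[OF kp] reach_symmetric[OF lK] by blast
  then obtain j where "(edge ^^ j) k l" using reach_def by blast
  then have j: "l \<in> cyclic_class k j" by (auto simp: cyclic_class_def)
  then have "[j + n = i + n] (mod per k)"
    using cyclic_class_disjoint[OF assms(1) cyclic_class_step[OF j assms(2)] p] by simp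
  then have "[j = i] (mod per k)" by (simp add: cong_add_rcancel_nat)
  then show "l \<in> cyclic_class k i" using j cyclic_class_cong by blast
qed (use cyclic_class_step assms in blast)

lemma cyclic_class_connected:
  assumes "k \<in> K" "l \<in> cyclic_class k i" "p \<in> cyclic_class k i"
  shows "\<exists>n. per k dvd n \<and> (edge ^^ n) l p"
proof -
  obtain m n where mn: "(edge ^^ m) k l" "[m = i] (mod per k)" "(edge ^^ n) k p" "[n = i] (mod per k)"
    using assms by (auto simp: cyclic_class_def)
  obtain r where r: "(edge ^^ r) l k" using reach_sym[OF assms(1) mn(1)] by blast
  have "[m = n] (mod per k)" using mn(2,4) by (blast intro: cong_sym cong_trans)
  moreover have "[r + m = 0] (mod per k)"
    using per_dvd[OF path_trans[OF mn(1) r]] by (simp add: cong_0_iff add.commute)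
  moreover from calculation have "[r + m = r + n] (mod per k)" by (intro cong_add) auto
  ultimately have "[r + n = 0] (mod per k)" by (blast intro: cong_sym cong_trans)
  then show ?thesis using path_trans[OF r mn(3)] by (auto simp: cong_0_iff)
qed

lemma ex_path: "\<exists>l. (edge ^^ n) k l"
proof (induction n)
  case (Suc n)
  then obtain l where l: "(edge ^^ n) k l" by blast
  obtain p where "edge l p" using ex_edge by blast
  then show ?case using l relpowp_Suc_I by metis
qed auto

lemma cyclic_class_nonempty: "\<exists>l. l \<in> cyclic_class k i"
  using ex_path[of i k] cong_refl unfolding cyclic_class_def by blast

lemma ex_pred:
  assumes "p \<in> K" shows "\<exists>l. (edge ^^ n) l p"
proof -
  obtain r where r: "r \<ge> 1" "(edge ^^ r) p p" using ex_cycle[OF assms] by blast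
  have "(edge ^^ (t * r)) p p" for t
  proof (induction t)
    case (Suc t)
    then show ?case using path_trans[OF r(2) Suc] by simp
  qed simp
  \<comment> \<open>Going \<open>n\<close> times around the loop takes \<open>n * r\<close> steps,
    at least \<open>n\<close> since \<open>r\<close> is positive; the vertex \<open>n\<close> steps
    before the end is the predecessor.\<close>
  then have "(edge ^^ ((n * r - n) + n)) p p" using r(1) by simp
  then show ?thesis unfolding relpowp_add by blast
qed

end

section \<open>Exactness of the cyclic classes\<close>

context surjective_markov_map
begin

text \<open>Closed intervals make membership in \<open>markov_algebra a\<close> literal; their
  overlaps at endpoints are null.\<close>

definition cells :: "int set \<Rightarrow> real set" where "cells S = (\<Union>l\<in>S. markov_interval a l)"

lemma cells_borel [simp]: "cells S \<in> sets borel"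
  unfolding cells_def by (intro sets.countable_UN'') (auto simp: markov_interval_def)

lemma cells_iff: "x \<in> cell l \<Longrightarrow> x \<in> cells S \<longleftrightarrow> l \<in> S"
proof
  assume l: "x \<in> cell l" and "x \<in> cells S"
  then obtain j where j: "j \<in> S" "x \<in> markov_interval a j" by (auto simp: cells_def)
  then have "x \<in> cell j"
    using cell_not_end[OF l] unfolding markov_interval_def cell_def
    by (metis atLeastAtMost_iff greaterThanLessThan_iff order_le_less rangeI)
  then show "l \<in> S" using cell_unique[OF l] j(1) by simp
qed (use cell_subset_markov_interval in \<open>auto simp: cells_def\<close>)

lemma AE_cells: "AE x in lborel. \<forall>S. x \<in> cells S \<longleftrightarrow> (\<exists>l\<in>S. x \<in> cell l)"
  using AE_regular
proof eventually_elim
  case (elim x)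
  then obtain l where l: "x \<in> cell l" using regular_cell by blast
  then show ?case using cells_iff[OF l] cell_unique[OF l] by blast
qed

lemma cells_markov_algebra: "cells S \<in> markov_algebra a"
proof -
  have "countable S" by simp
  then have "(\<Union>l\<in>S. markov_interval a l) \<in> sigma_sets UNIV (range (markov_interval a))"
    by (intro sigma_sets_UNION) (auto intro: sigma_sets.Basic)
  then show ?thesis by (simp add: markov_algebra_def cells_def)
qed

lemma markov_interval_subset_mod_cells: "markov_interval a j \<subseteq>\<^sub>m cells S \<longleftrightarrow> j \<in> S"
proof
  assume "markov_interval a j \<subseteq>\<^sub>m cells S"
  then obtain x where "x \<in> cell j" "x \<in> markov_interval a j \<longrightarrow> x \<in> cells S"
    using ex_AE_not_negligible[OF cell_not_negligible] unfolding subset_mod_def by blast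
  then show "j \<in> S" using cells_iff cell_subset_markov_interval by blast
qed (auto simp: cells_def subset_mod_def)

lemma cells_emeasure_pos: "l \<in> S \<Longrightarrow> 0 < emeasure lborel (cells S)"
proof -
  assume "l \<in> S"
  then have "cell l \<subseteq> cells S" using cell_subset_markov_interval by (auto simp: cells_def)
  then show ?thesis using cell_pos[of l] emeasure_mono[of "cell l" "cells S" lborel]
    by (simp add: order_less_le_trans)
qed

lemma not_negligible_meets_cell:
  assumes "\<not> negligible A" "A \<subseteq>\<^sub>m cells S"
  obtains l where "l \<in> S" "\<not> negligible (A \<inter> cell l)"
proof -
  have "\<exists>l\<in>S. \<not> negligible (A \<inter> cell l)"
  proof (rule ccontr)
    assume "\<not> ?thesis"
    then have "AE x in lborel. \<forall>l. l \<in> S \<longrightarrow> x \<notin> A \<inter> cell l"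
      by (subst AE_all_countable) (auto simp: negligible_iff_AE)
    with AE_cells assms(2)[unfolded subset_mod_def] have "AE x in lborel. x \<notin> A"
      by eventually_elim blast
    then show False using assms(1) by (simp add: negligible_iff_AE)
  qed
  then show thesis using that by blast
qed

lemma cells_subset_mod:
  assumes "\<And>l. l \<in> S \<Longrightarrow> cell l \<subseteq>\<^sub>m A" shows "cells S \<subseteq>\<^sub>m A"
proof -
  have "AE x in lborel. \<forall>l. l \<in> S \<longrightarrow> x \<in> cell l \<longrightarrow> x \<in> A"
    using assms unfolding AE_all_countable subset_mod_def by auto
  with AE_cells show ?thesis unfolding subset_mod_def by eventually_elim blast
qed

lemma invariant_iterate: "A =\<^sub>m (T ^^ e) -` A \<Longrightarrow> A =\<^sub>m (T ^^ (e * n)) -` A"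
proof (induction n)
  case (Suc n)
  have "AE x in lborel. (T ^^ e) x \<in> A \<longleftrightarrow> (T ^^ (e * n)) ((T ^^ e) x) \<in> A"
    using AE_Tn[OF Suc.IH[OF Suc.prems, unfolded eq_mod_def vimage_eq], of e] .
  with Suc.prems show ?case
    unfolding eq_mod_def vimage_eq
  proof eventually_elim
    case (elim x)
    have "(T ^^ (e * Suc n)) x = (T ^^ (e * n)) ((T ^^ e) x)"
      by (metis add.commute comp_apply funpow_add mult_Suc_right)
    then show ?case using elim by simp
  qed
qed (simp add: eq_mod_def)

text \<open>Reduces invariance to the transition graph: for a regular point both sides depend only
  on the cells at times \<open>0\<close> and \<open>n\<close>.\<close>

lemma AE_preimage_cells:
  assumes "\<And>l p. (edge ^^ n) l p \<Longrightarrow> p \<in> S' \<longleftrightarrow> l \<in> S"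
  shows "(T ^^ n) -` cells S' =\<^sub>m cells S"
  unfolding eq_mod_def using AE_regular
proof eventually_elim
  case (elim x)
  obtain l p where l: "x \<in> cell l" and p: "(T ^^ n) x \<in> cell p"
    using elim regular_cell regular_Tn by blast
  have "(edge ^^ n) l p" using Tn_steps elim l p by blast
  then show ?case using cells_iff[OF l] cells_iff[OF p] assms by simp
qed

lemma AE_image_cells:
  assumes "\<And>l p. edge l p \<Longrightarrow> l \<in> S \<Longrightarrow> p \<in> S'" and "\<And>p. p \<in> S' \<Longrightarrow> \<exists>l\<in>S. edge l p"
  shows "T ` cells S =\<^sub>m cells S'"
proof -
  have "countable (T ` range a)" by simp
  then have "AE x in lborel. x \<notin> T ` range a"
    using countable_negligible negligible_iff_AE by blast
  with AE_regular show ?thesis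
    unfolding eq_mod_def
  proof eventually_elim
    case (elim y)
    obtain p where p: "y \<in> cell p" using elim regular_cell by blast
    show ?case
    proof
      assume "y \<in> T ` cells S"
      then obtain x where x: "x \<in> cells S" "y = T x" by blast
      then obtain l where l: "x \<in> cell l" using cell_cover elim by blast
      then show "y \<in> cells S'"
        using T_step[OF l] p x cells_iff[OF l] cells_iff[OF p] assms(1) by blast
    next
      assume "y \<in> cells S'"
      then obtain l where l: "l \<in> S" "edge l p" using assms(2) cells_iff[OF p] by blast
      then have "y \<in> T ` cell l" using path_covers[of 1 l p] p by auto
      then show "y \<in> T ` cells S"
        using l(1) cells_iff[of _ l S] by blast
    qed
  qed
qed

text \<open>Orbits through endpoints could contribute to the image, but only countably many points,
  collected in \<open>N\<close>. A regular point outside \<open>N\<close> has only regular preimages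
  under \<open>T ^^ n\<close>, and these have itineraries.\<close>

lemma markov_interval_covers_iff:
  "markov_interval a j \<subseteq>\<^sub>m (T ^^ n) ` markov_interval a j \<longleftrightarrow> (edge ^^ n) j j"
proof
  assume *: "markov_interval a j \<subseteq>\<^sub>m (T ^^ n) ` markov_interval a j"
  define N where "N = (\<Union>i\<le>n. (T ^^ i) ` range a)"
  have "countable N" unfolding N_def by (intro countable_UN) auto
  then have "AE x in lborel. x \<notin> N"
    using countable_negligible negligible_iff_AE by blast
  with AE_regular *[unfolded subset_mod_def]
  have "AE x in lborel. regular x \<and> x \<notin> N \<and> (x \<in> markov_interval a j \<longrightarrow> x \<in> (T ^^ n) ` markov_interval a j)"
    by eventually_elim blast
  then obtain x where x: "x \<in> cell j" "regular x" "x \<notin> N"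
    "x \<in> markov_interval a j \<longrightarrow> x \<in> (T ^^ n) ` markov_interval a j"
    by (rule ex_AE_not_negligible[OF cell_not_negligible]) blast
  then obtain y where y: "y \<in> markov_interval a j" "x = (T ^^ n) y"
    using cell_subset_markov_interval by blast
  have reg: "regular y"
    unfolding regular_def
  proof (intro allI notI)
    fix i assume i: "(T ^^ i) y \<in> range a"
    show False
    proof (cases "i \<le> n")
      case True
      then have "x = (T ^^ (n - i)) ((T ^^ i) y)"
        using y(2) by (metis comp_apply funpow_add le_add_diff_inverse2)
      then show False using i x(3) unfolding N_def by (metis UN_iff atMost_iff diff_le_self image_eqI)
    next
      case False
      then have "(T ^^ i) y = (T ^^ (i - n)) x"
        using y(2) by (metis comp_apply funpow_add le_add_diff_inverse2 nat_le_linear)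
      then show False using x(2) i unfolding regular_def by simp
    qed
  qed
  then obtain l where l: "y \<in> cell l" using regular_cell by blast
  then have "l = j"
    using cells_iff[OF l, of "{j}"] y(1) by (simp add: cells_def)
  then show "(edge ^^ n) j j" using Tn_steps[OF reg l, of n j] x(1) y(2) by simp
next
  assume "(edge ^^ n) j j"
  then have "cell j \<subseteq> (T ^^ n) ` markov_interval a j"
    using path_covers cell_subset_markov_interval by (meson image_mono order_trans)
  moreover have "AE x in lborel. x \<in> markov_interval a j \<longrightarrow> x \<in> cell j"
    using AE_cells by eventually_elim (auto simp: cells_def dest: spec[of _ "{j}"])
  ultimately show "markov_interval a j \<subseteq>\<^sub>m (T ^^ n) ` markov_interval a j"
    unfolding subset_mod_def by (auto elim: eventually_mono)
qed

end

context conservative_region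
begin

section \<open>Invariant sets and tail sets of the cyclic classes\<close>

lemma period_eq_per: "period a T k = per k"
  by (simp add: period_def per_def markov_interval_covers_iff)

lemma cells_subset_X: "S \<subseteq> K \<Longrightarrow> cells S \<subseteq>\<^sub>m X"
  using K_full by (intro cells_subset_mod) auto

text \<open>Used with \<open>e = 1\<close> for reachability classes and with
  \<open>e = per k\<close> for cyclic classes. One cell is filled by \<open>full_cell\<close>; paths
  of length divisible by \<open>e\<close> carry this to the others.\<close>

lemma invariant_subset_full:
  assumes S: "S \<subseteq> K" and A: "A \<in> sets borel" "A \<subseteq>\<^sub>m cells S" "\<not> negligible A"
    and inv: "A =\<^sub>m (T ^^ e) -` A"
    and loops: "\<And>l n. l \<in> S \<Longrightarrow> (edge ^^ n) l l \<Longrightarrow> e dvd n"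
    and conn: "\<And>l p. l \<in> S \<Longrightarrow> p \<in> S \<Longrightarrow> \<exists>n. e dvd n \<and> (edge ^^ n) l p"
  shows "cells S \<subseteq>\<^sub>m A"
proof (rule cells_subset_mod)
  have AX: "A \<subseteq>\<^sub>m X"
    using A(2) cells_subset_X[OF S] unfolding subset_mod_def by eventually_elim auto
  have inv': "A =\<^sub>m (T ^^ n) -` A" if "e dvd n" for n
    using invariant_iterate[OF inv] that by (auto simp: dvd_def)
  obtain l where l: "l \<in> S" "\<not> negligible (A \<inter> cell l)"
    using not_negligible_meets_cell[OF A(3,2)] by blast
  have full: "cell l \<subseteq>\<^sub>m A"
    using full_cell[OF A(1) AX l(2)] inv' loops[OF l(1)] by blast
  fix p assume "p \<in> S"
  then obtain n where n: "e dvd n" "(edge ^^ n) l p" using conn[OF l(1)] by blast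
  have "cell l \<subseteq>\<^sub>m (T ^^ n) -` A"
    using full inv'[OF n(1)] unfolding subset_mod_def eq_mod_def by eventually_elim auto
  then show "cell p \<subseteq>\<^sub>m A" by (rule full_image[OF n(2)])
qed

lemma cyclic_class_subset_K: "k \<in> K \<Longrightarrow> cyclic_class k i \<subseteq> K"
  using cyclic_class_reach K_reach by blast

lemma cyclic_class_invariant:
  assumes "k \<in> K" shows "(T ^^ n) -` cells (cyclic_class k (i + n)) =\<^sub>m cells (cyclic_class k i)"
  by (rule AE_preimage_cells) (rule cyclic_class_step_iff[OF assms])

lemma cyclic_class_invariant_per:
  assumes "k \<in> K" "per k dvd n"
  shows "(T ^^ n) -` cells (cyclic_class k i) =\<^sub>m cells (cyclic_class k i)"
proof -
  have "cyclic_class k (i + n) = cyclic_class k i"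
    using assms(2) by (intro cyclic_class_cong) (auto simp: cong_def dvd_def)
  then show ?thesis using cyclic_class_invariant[OF assms(1), of n i] by simp
qed

lemma cyclic_class_image:
  assumes "k \<in> K" shows "T ` cells (cyclic_class k i) =\<^sub>m cells (cyclic_class k (Suc i))"
proof (rule AE_image_cells)
  fix l p assume "edge l p" "l \<in> cyclic_class k i"
  then show "p \<in> cyclic_class k (Suc i)" using cyclic_class_step[of l k i 1 p] by (simp add: eq_OO)
next
  fix p assume p: "p \<in> cyclic_class k (Suc i)"
  then have "p \<in> K" using cyclic_class_subset_K[OF assms] by blast
  then obtain l where "(edge ^^ 1) l p" using ex_pred by blast
  then show "\<exists>l\<in>cyclic_class k i. edge l p"
    using cyclic_class_step_iff[OF assms, of 1 l p i] p by (auto simp: eq_OO)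
qed

lemma cyclic_class_invariant_full:
  assumes k: "k \<in> K" and A: "A \<in> sets borel" "A \<subseteq>\<^sub>m cells (cyclic_class k i)" "\<not> negligible A"
    and inv: "A =\<^sub>m (T ^^ per k) -` A"
  shows "cells (cyclic_class k i) \<subseteq>\<^sub>m A"
proof (rule invariant_subset_full[OF cyclic_class_subset_K[OF k] A inv])
  fix l n assume "l \<in> cyclic_class k i" "(edge ^^ n) l l"
  then show "per k dvd n" using per_dvd[of n l] per_reach[OF k cyclic_class_reach] by simp
qed (use cyclic_class_connected[OF k] in blast)

text \<open>If the preimage of \<open>B\<close> nearly fills \<open>cell l\<close>, so does
  \<open>B\<close>: what \<open>B\<close> misses pulls back along \<open>u\<close> into
  \<open>cell l\<close>. The loss depends on the measure of the cylinder.\<close>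

lemma measure_cell_diff_le:
  assumes u: "cyl (u @ [l]) \<noteq> {}" "cyl (u @ [l]) \<subseteq> cell l" and B: "B \<in> sets borel"
  shows "measure lborel (cell l - B) * measure lborel (cyl (u @ [l])) \<le>
    distortion_const\<^sup>2 * measure lborel (cell l) * measure lborel (cell l - (T ^^ length u) -` B)"
proof -
  have "measure lborel (cyl (u @ [l]) \<inter> (T ^^ length u) -` (cell l - B))
      \<le> measure lborel (cell l - (T ^^ length u) -` B)"
  proof (rule measure_mono_fmeasurable)
    show "cell l - (T ^^ length u) -` B \<in> fmeasurable lborel"
      using Tn_vimage_borel[OF B] cell_finite[of l] emeasure_mono[of "cell l - (T ^^ length u) -` B" "cell l" lborel]
      by (intro fmeasurableI) (auto simp: order_le_less_trans)
    show "cyl (u @ [l]) \<inter> (T ^^ length u) -` (cell l - B) \<in> sets lborel"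
      using B Tn_vimage_borel[of "cell l - B"] by auto
  qed (use u in auto)
  then show ?thesis
    using cyl_bounded_distortion[OF u(1), of "cell l - B"] B
    by (smt (verit) Diff_subset cell_borel measure_nonneg mult_left_mono mult_nonneg_nonneg sets.Diff zero_le_power2)
qed

text \<open>At a time when \<open>A\<close> nearly fills \<open>cell l\<close>, return paths of lengths \<open>q\<close> and \<open>q + per k\<close> spread
  it over \<open>cell l\<close> at two times that differ by \<open>per k\<close>.\<close>

lemma tail_set_overlap:
  assumes k: "k \<in> K" and A: "A \<in> sets borel" "A \<subseteq>\<^sub>m cells (cyclic_class k i)" "\<not> negligible A"
    and tail: "\<And>n. per k dvd n \<Longrightarrow> \<exists>B\<in>sets borel. A =\<^sub>m (T ^^ n) -` B"
  shows "\<not> negligible (A \<inter> (T ^^ per k) -` A)"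
proof -
  let ?d = "per k" and ?M = "\<lambda>l. distortion_const\<^sup>2 * measure lborel (cell l)"
  obtain l where l: "l \<in> cyclic_class k i" "\<not> negligible (A \<inter> cell l)"
    using not_negligible_meets_cell[OF A(3,2)] by blast
  have lK: "l \<in> K" using l(1) cyclic_class_subset_K[OF k] by blast
  have per_l: "per l = ?d" using per_reach[OF k cyclic_class_reach[OF l(1)]] .
  obtain q where q: "(edge ^^ q) l l" "(edge ^^ (q + ?d)) l l"
    using ex_consecutive_cycles[OF lK] per_l by metis
  have dq: "?d dvd q" using per_dvd[OF q(1)] per_l by simp
  obtain u where u: "length u = q" "cyl (u @ [l]) \<noteq> {}" "cyl (u @ [l]) \<subseteq> cell l"
    using path_word[OF q(1)] by blast
  obtain v where v: "length v = q + ?d" "cyl (v @ [l]) \<noteq> {}" "cyl (v @ [l]) \<subseteq> cell l"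
    using path_word[OF q(2)] by blast
  define m where "m = measure lborel (cell l)"
  have m: "0 < m" using gap(1)[of l] by (simp add: m_def cell_def)
  have M: "0 < ?M l" using distortion_const_pos m by (simp add: m_def)
  define z where "z = min (measure lborel (cyl (u @ [l]))) (measure lborel (cyl (v @ [l])))"
  have z: "0 < z" using cyl_measure_pos u(2) v(2) by (simp add: z_def)
  \<comment> \<open>Chosen so that after the loss along either \<open>u\<close> or \<open>v\<close>
    less than half of \<open>cell l\<close> is missing.\<close>
  define e where "e = m / 2 * z / ?M l"
  have e: "0 < e" unfolding e_def by (rule divide_pos_pos[OF mult_pos_pos[OF half_gt_zero[OF m] z] M])
  have AX: "A \<subseteq>\<^sub>m X"
    using A(2) cells_subset_X[OF cyclic_class_subset_K[OF k]] unfolding subset_mod_def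
    by eventually_elim auto
  obtain n where n: "(edge ^^ n) l l"
    "\<And>B. B \<in> sets borel \<Longrightarrow> A =\<^sub>m (T ^^ n) -` B \<Longrightarrow> measure lborel (cell l - B) < e"
    using ex_time_almost_full_return[OF A(1) AX l(2) e] by blast
  have dn: "?d dvd n" using per_dvd[OF n(1)] per_l by simp
  \<comment> \<open>After time \<open>n\<close>, all \<open>q + ?d\<close> further steps lead to
    \<open>B\<close>, while \<open>q\<close> steps lead to its preimage under
    \<open>T ^^ ?d\<close>.\<close>
  define N where "N = n + (q + ?d)"
  have "?d dvd N" using dn dq by (simp add: N_def)
  from tail[OF this] obtain B where B: "B \<in> sets borel" "A =\<^sub>m (T ^^ N) -` B" by blast
  have "(T ^^ N) -` B = (T ^^ n) -` ((T ^^ (q + ?d)) -` B)"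
    unfolding vimage_comp funpow_add[symmetric] N_def by (simp add: add.commute add.left_commute)
  then have small: "measure lborel (cell l - (T ^^ (q + ?d)) -` B) < e"
    using n(2)[OF Tn_vimage_borel[OF B(1)]] B(2) by simp
  have half: "measure lborel (cell l - C) < m / 2"
    if C: "C \<in> sets borel" "measure lborel (cell l - (T ^^ length w) -` C) < e"
      and w: "cyl (w @ [l]) \<noteq> {}" "cyl (w @ [l]) \<subseteq> cell l" "z \<le> measure lborel (cyl (w @ [l]))" for C w
  proof -
    have "measure lborel (cell l - C) * z \<le> measure lborel (cell l - C) * measure lborel (cyl (w @ [l]))"
      using w(3) by (intro mult_left_mono) auto
    also have "\<dots> \<le> ?M l * measure lborel (cell l - (T ^^ length w) -` C)"
      by (rule measure_cell_diff_le[OF w(1,2) C(1)])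
    also have "\<dots> < ?M l * e"
      using C(2) M by (rule mult_strict_left_mono)
    also have "\<dots> = m / 2 * z"
      unfolding e_def using M by (metis less_irrefl nonzero_mult_div_cancel_left times_divide_eq_right)
    finally show ?thesis using z by simp
  qed
  let ?D = "(T ^^ ?d) -` B"
  have D: "?D \<in> sets borel" by (rule Tn_vimage_borel[OF B(1)])
  have qD: "(T ^^ q) -` ?D = (T ^^ (q + ?d)) -` B"
    unfolding vimage_comp funpow_add[symmetric] by (simp add: add.commute)
  have "measure lborel (cell l - B) < m / 2"
    using small v by (intro half[OF B(1), of v]) (auto simp: z_def)
  moreover have "measure lborel (cell l - ?D) < m / 2"
    using small u qD by (intro half[OF D, of u]) (auto simp: z_def)
  moreover have fm: "cell l - B \<in> fmeasurable lborel" "cell l - ?D \<in> fmeasurable lborel"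
    using B(1) D cell_finite[of l] emeasure_mono[of "cell l - B" "cell l" lborel]
      emeasure_mono[of "cell l - ?D" "cell l" lborel]
    by (auto intro!: fmeasurableI simp: order_le_less_trans)
  ultimately have lt: "measure lborel ((cell l - B) \<union> (cell l - ?D)) < m"
    using measure_Un_le[of "cell l - B" lborel "cell l - ?D"] fmeasurableD by fastforce
  have Y: "\<not> negligible (cell l \<inter> (B \<inter> ?D))"
  proof
    assume "negligible (cell l \<inter> (B \<inter> ?D))"
    then have "AE x in lborel. x \<in> cell l \<longleftrightarrow> x \<in> (cell l - B) \<union> (cell l - ?D)"
      unfolding negligible_iff_AE by eventually_elim auto
    then have "measure lborel (cell l) = measure lborel ((cell l - B) \<union> (cell l - ?D))"
      using fm[THEN fmeasurableD] by (intro measure_eq_AE sets.Un) auto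
    then show False using lt by (simp add: m_def)
  qed
  \<comment> \<open>Modulo null sets, the pullback of \<open>B \<inter> ?D\<close> by
    \<open>T ^^ N\<close> is the overlap in question. A path of length \<open>N\<close> into
    \<open>l\<close> prevents this pullback from being null.\<close>
  obtain j where j: "(edge ^^ N) j l" using ex_pred[OF lK] by blast
  show ?thesis
  proof
    assume "negligible (A \<inter> (T ^^ ?d) -` A)"
    then have "AE x in lborel. x \<notin> A \<inter> (T ^^ ?d) -` A" by (simp add: negligible_iff_AE)
    with B(2)[unfolded eq_mod_def] AE_Tn[OF B(2)[unfolded eq_mod_def], of ?d]
    have "AE x in lborel. x \<notin> (T ^^ N) -` (B \<inter> ?D)"
    proof eventually_elim
      case (elim x)
      have "(T ^^ N) ((T ^^ ?d) x) = (T ^^ ?d) ((T ^^ N) x)"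
        by (metis add.commute comp_apply funpow_add)
      then show ?case using elim by auto
    qed
    then have "cell j \<subseteq>\<^sub>m (T ^^ N) -` (- (B \<inter> ?D))"
      unfolding subset_mod_def by eventually_elim auto
    then have "cell l \<subseteq>\<^sub>m - (B \<inter> ?D)" by (rule full_image[OF j])
    then have "AE x in lborel. x \<notin> cell l \<inter> (B \<inter> ?D)"
      unfolding subset_mod_def by eventually_elim auto
    then show False using Y unfolding negligible_iff_AE by (rule notE[rotated])
  qed
qed

text \<open>Both differences of \<open>A\<close> and its preimage are again of tail type, and each
  is disjoint from its own preimage under \<open>T ^^ per k\<close>; by
  \<open>tail_set_overlap\<close> they are null.\<close>

lemma tail_set_invariant:
  assumes k: "k \<in> K" and A: "A \<in> sets borel" "A \<subseteq>\<^sub>m cells (cyclic_class k i)"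
    and tail: "\<And>n. per k dvd n \<Longrightarrow> \<exists>B\<in>sets borel. A =\<^sub>m (T ^^ n) -` B"
  shows "A =\<^sub>m (T ^^ per k) -` A"
proof -
  let ?S = "T ^^ per k"
  have commute: "(T ^^ n) (?S x) = ?S ((T ^^ n) x)" for n x
    by (metis add.commute comp_apply funpow_add)
  have SA: "?S -` A \<in> sets borel" by (rule Tn_vimage_borel[OF A(1)])
  have "AE x in lborel. x \<in> ?S -` A \<longrightarrow> x \<in> ?S -` cells (cyclic_class k i)"
    using AE_Tn[OF A(2)[unfolded subset_mod_def], of "per k"] by simp
  with cyclic_class_invariant_per[OF k dvd_refl, of i, unfolded eq_mod_def]
  have SAC: "?S -` A \<subseteq>\<^sub>m cells (cyclic_class k i)"
    unfolding subset_mod_def by eventually_elim auto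
  have 1: "negligible (A - ?S -` A)"
  proof (rule ccontr)
    assume neg: "\<not> ?thesis"
    have sub: "A - ?S -` A \<subseteq>\<^sub>m cells (cyclic_class k i)"
      using A(2) unfolding subset_mod_def by eventually_elim auto
    have "\<exists>B\<in>sets borel. A - ?S -` A =\<^sub>m (T ^^ n) -` B" if n: "per k dvd n" for n
    proof -
      obtain B where B: "B \<in> sets borel" "A =\<^sub>m (T ^^ n) -` B" using tail[OF n] by blast
      have "A - ?S -` A =\<^sub>m (T ^^ n) -` (B - ?S -` B)"
        using B(2) AE_Tn[OF B(2)[unfolded eq_mod_def], of "per k"] unfolding eq_mod_def
        by eventually_elim (auto simp: commute)
      then show ?thesis by (rule bexI) (use B(1) Tn_vimage_borel[OF B(1)] in auto)
    qed
    from tail_set_overlap[OF k _ sub neg this] A(1) SA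
    have "\<not> negligible ((A - ?S -` A) \<inter> ?S -` (A - ?S -` A))" by blast
    moreover have "(A - ?S -` A) \<inter> ?S -` (A - ?S -` A) = {}" by auto
    ultimately show False by simp
  qed
  have 2: "negligible (?S -` A - A)"
  proof (rule ccontr)
    assume neg: "\<not> ?thesis"
    have sub: "?S -` A - A \<subseteq>\<^sub>m cells (cyclic_class k i)"
      using SAC unfolding subset_mod_def by eventually_elim auto
    have "\<exists>B\<in>sets borel. ?S -` A - A =\<^sub>m (T ^^ n) -` B" if n: "per k dvd n" for n
    proof -
      obtain B where B: "B \<in> sets borel" "A =\<^sub>m (T ^^ n) -` B" using tail[OF n] by blast
      have "?S -` A - A =\<^sub>m (T ^^ n) -` (?S -` B - B)"
        using B(2) AE_Tn[OF B(2)[unfolded eq_mod_def], of "per k"] unfolding eq_mod_def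
        by eventually_elim (auto simp: commute)
      then show ?thesis by (rule bexI) (use B(1) Tn_vimage_borel[OF B(1)] in auto)
    qed
    from tail_set_overlap[OF k _ sub neg this] A(1) SA
    have "\<not> negligible ((?S -` A - A) \<inter> ?S -` (?S -` A - A))" by blast
    moreover have "(?S -` A - A) \<inter> ?S -` (?S -` A - A) = {}" by auto
    ultimately show False by simp
  qed
  from 1 2 show ?thesis
    unfolding negligible_iff_AE eq_mod_def by eventually_elim auto
qed

end

section \<open>The spectral decomposition\<close>

lemma eq_mod_if_subset_mod:
  fixes A B :: "real set"
  assumes "A \<subseteq>\<^sub>m B" "B \<subseteq>\<^sub>m A" shows "A =\<^sub>m B"
  using assms unfolding subset_mod_def eq_mod_def by eventually_elim auto

lemma eq_mod_empty_iff: "A =\<^sub>m {} \<longleftrightarrow> negligible A"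
  by (simp add: eq_mod_def negligible_iff_AE)

context conservative_region
begin

lemma cyclic_class_exact:
  assumes k: "k \<in> K"
  shows "exact_component (T ^^ per k) (cells (cyclic_class k i))"
proof -
  let ?F = "cells (cyclic_class k i)" and ?S = "T ^^ per k"
  \<comment> \<open>Serves both halves: ergodicity applies it to invariant sets, exactness to tail
    sets once these are known to be invariant.\<close>
  have full: "B =\<^sub>m {} \<or> B =\<^sub>m ?F" if "B \<in> sets borel" "B \<subseteq>\<^sub>m ?F" "B =\<^sub>m ?S -` B" for B
    using cyclic_class_invariant_full[OF k that(1,2) _ that(3)] that(2)
    by (auto simp: eq_mod_empty_iff intro: eq_mod_if_subset_mod)
  have "invariant_set ?S ?F"
    using cyclic_class_invariant_per[OF k dvd_refl] by (simp add: invariant_set_def)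
  moreover have "0 < emeasure lborel ?F"
    using cyclic_class_nonempty cells_emeasure_pos by blast
  moreover have "B =\<^sub>m {} \<or> B =\<^sub>m ?F" if B: "invariant_set ?S B" "B \<subseteq>\<^sub>m ?F" for B
  proof (rule full[OF _ B(2)])
    show "B =\<^sub>m ?S -` B" using B(1) unfolding invariant_set_def eq_mod_def by (auto elim: eventually_mono)
  qed (use B(1) in \<open>simp add: invariant_set_def\<close>)
  moreover have "A =\<^sub>m {} \<or> A =\<^sub>m ?F" if A: "A \<in> tail_sets ?S ?F" for A
  proof (rule full)
    have A': "A \<in> sets borel" "A \<subseteq> ?F"
      "\<And>n. \<exists>B\<in>sets borel. B \<subseteq> ?F \<and> A =\<^sub>m ?F \<inter> (?S ^^ n) -` B"
      using A unfolding tail_sets_def by blast+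
    show "A \<in> sets borel" by (rule A')
    show sub: "A \<subseteq>\<^sub>m ?F" using A'(2) by (auto simp: subset_mod_def)
    \<comment> \<open>As \<open>B\<close> lies in the invariant set \<open>?F\<close>, intersecting
      its preimage with \<open>?F\<close> changes only a null set, so \<open>A\<close> is a plain
      preimage.\<close>
    have tail: "\<exists>B\<in>sets borel. A =\<^sub>m (T ^^ n) -` B" if n: "per k dvd n" for n
    proof -
      obtain m where m: "n = per k * m" using n by blast
      obtain B where B: "B \<in> sets borel" "B \<subseteq> ?F" "A =\<^sub>m ?F \<inter> (?S ^^ m) -` B" using A'(3) by blast
      have "(?S ^^ m) = T ^^ n" by (simp only: funpow_mult m)
      then have "A =\<^sub>m (T ^^ n) -` B"
        using B(2,3) cyclic_class_invariant_per[OF k n, of i] unfolding eq_mod_def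
        by (auto elim!: eventually_elim2)
      then show ?thesis using B(1) by blast
    qed
    show "A =\<^sub>m ?S -` A" by (rule tail_set_invariant[OF k A'(1) sub tail])
  qed
  ultimately show ?thesis
    unfolding exact_component_def ergodic_component_def by blast
qed

section \<open>Ergodic components as reachability classes\<close>

definition component :: "int \<Rightarrow> real set" where "component k = cells {l. reach k l}"

lemma component_ergodic:
  assumes k: "k \<in> K" shows "ergodic_component T (component k)"
  unfolding ergodic_component_def
proof (intro conjI allI impI)
  have step: "reach k p \<longleftrightarrow> reach k l" if "(edge ^^ 1) l p" for l p
  proof
    have lp: "reach l p" using that reach_def by blast
    then show "reach k l \<Longrightarrow> reach k p" by (rule reach_trans[rotated])
    assume kp: "reach k p"
    then have "l \<in> K" using K_backward[OF K_reach[OF k] that] by blast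
    then show "reach k l" using reach_trans[OF kp reach_symmetric[OF _ lp]] by blast
  qed
  have "(T ^^ 1) -` component k =\<^sub>m component k"
    unfolding component_def by (rule AE_preimage_cells) (use step in blast)
  then show "invariant_set T (component k)"
    by (simp add: invariant_set_def component_def)
  show "0 < emeasure lborel (component k)"
    unfolding component_def by (rule cells_emeasure_pos[of k]) simp
  fix B assume B: "invariant_set T B \<and> B \<subseteq>\<^sub>m component k"
  have inv: "B =\<^sub>m (T ^^ 1) -` B"
    using B unfolding invariant_set_def eq_mod_def by (auto elim: eventually_mono)
  have "component k \<subseteq>\<^sub>m B" if "\<not> negligible B"
    unfolding component_def
  proof (rule invariant_subset_full[OF _ _ _ that inv])
    fix l p assume "l \<in> {l. reach k l}" "p \<in> {l. reach k l}"
    then have "reach l p" using reach_trans[OF reach_symmetric[OF k]] by blast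
    then show "\<exists>n. 1 dvd n \<and> (edge ^^ n) l p" by (simp add: reach_def)
  qed (use B K_reach[OF k] in \<open>auto simp: invariant_set_def component_def\<close>)
  then show "B =\<^sub>m {} \<or> B =\<^sub>m component k"
    using B by (auto simp: eq_mod_empty_iff intro: eq_mod_if_subset_mod)
qed

text \<open>By symmetry, reachability classes with a common cell coincide.\<close>

lemma component_disjoint:
  assumes "k \<in> K" "k' \<in> K" "component k \<noteq> component k'"
  shows "component k \<inter> component k' =\<^sub>m {}"
proof -
  have no: "\<not> (reach k l \<and> reach k' l)" for l
  proof
    assume "reach k l \<and> reach k' l"
    then have "reach k k'" "reach k' k"
      using reach_trans reach_symmetric assms(1,2) by blast+
    then have "{l. reach k l} = {l. reach k' l}" using reach_trans by blast
    then show False using assms(3) by (simp add: component_def)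
  qed
  show ?thesis
    unfolding eq_mod_def component_def using AE_regular
  proof eventually_elim
    case (elim x)
    then obtain l where "x \<in> cell l" using regular_cell by blast
    then show ?case using cells_iff no by auto
  qed
qed

lemma X_eq_components: "X =\<^sub>m \<Union>(component ` K)"
proof (rule eq_mod_if_subset_mod)
  show "X \<subseteq>\<^sub>m \<Union>(component ` K)"
    using AE_X_K AE_regular unfolding subset_mod_def
  proof eventually_elim
    case (elim x)
    show ?case
    proof
      assume "x \<in> X"
      moreover obtain l where l: "x \<in> cell l" using elim regular_cell by blast
      ultimately have "l \<in> K" using elim by blast
      moreover have "x \<in> component l" using cells_iff[OF l] by (simp add: component_def)
      ultimately show "x \<in> \<Union>(component ` K)" by blast
    qed
  qed
  have "\<Union>(component ` K) = cells K"
    using K_reach reach_refl unfolding component_def cells_def by blast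
  then show "\<Union>(component ` K) \<subseteq>\<^sub>m X" using cells_subset_X[OF order_refl] by simp
qed

lemma component_periods:
  assumes "k \<in> K"
  shows "period a T ` {j. markov_interval a j \<subseteq>\<^sub>m component k} = {per k}"
proof -
  have "{j. markov_interval a j \<subseteq>\<^sub>m component k} = {l. reach k l}"
    by (simp add: component_def markov_interval_subset_mod_cells)
  moreover have "period a T l = per k" if "reach k l" for l
    by (simp only: period_eq_per per_reach[OF assms that])
  then have "period a T ` {l. reach k l} = (\<lambda>_. per k) ` {l. reach k l}"
    by (intro image_cong) auto
  moreover have "{l. reach k l} \<noteq> {}" using reach_refl by blast
  ultimately show ?thesis by (simp add: image_constant_conv)
qed

lemma component_cyclic_decomposition:
  assumes k: "k \<in> K"
  shows "component k = (\<Union>i<per k. cells (cyclic_class k i))"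
proof -
  have "{l. reach k l} = (\<Union>i<per k. cyclic_class k i)"
  proof (intro set_eqI iffI)
    fix l assume "l \<in> {l. reach k l}"
    then obtain n where n: "(edge ^^ n) k l" by (auto simp: reach_def)
    then have "l \<in> cyclic_class k (n mod per k)" by (auto simp: cyclic_class_def cong_def)
    then show "l \<in> (\<Union>i<per k. cyclic_class k i)" using per_pos[OF k] by (meson UN_I lessThan_iff mod_less_divisor)
  qed (use cyclic_class_reach in blast)
  then show ?thesis by (auto simp: component_def cells_def)
qed

lemma cyclic_classes_disjoint:
  assumes k: "k \<in> K" and "i < per k" "j < per k" "i \<noteq> j"
  shows "cells (cyclic_class k i) \<inter> cells (cyclic_class k j) =\<^sub>m {}"
  unfolding eq_mod_def using AE_regular
proof eventually_elim
  case (elim x)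
  then obtain l where l: "x \<in> cell l" using regular_cell by blast
  have "\<not> (l \<in> cyclic_class k i \<and> l \<in> cyclic_class k j)"
    using cyclic_class_disjoint[OF k] assms(2-4) by (metis cong_less_modulus_unique_nat)
  then show ?case using cells_iff[OF l] by auto
qed

theorem spectral_decomposition:
  "\<exists>\<E>. countable \<E> \<and>
    (\<forall>E\<in>\<E>. ergodic_component T E) \<and>
    (\<forall>E\<in>\<E>. \<forall>E'\<in>\<E>. E \<noteq> E' \<longrightarrow> E \<inter> E' =\<^sub>m {}) \<and>
    X =\<^sub>m \<Union>\<E> \<and>
    (\<forall>E\<in>\<E>. \<exists>d::nat.
      period a T ` {j. markov_interval a j \<subseteq>\<^sub>m E} = {d} \<and> 0 < d \<and>
      (\<exists>F :: nat \<Rightarrow> real set.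
        (\<forall>i<d. exact_component (T ^^ d) (F i) \<and> F i \<in> markov_algebra a) \<and>
        (\<forall>i<d. \<forall>i'<d. i \<noteq> i' \<longrightarrow> F i \<inter> F i' =\<^sub>m {}) \<and>
        E =\<^sub>m (\<Union>i<d. F i) \<and>
        (\<forall>i. i + 1 < d \<longrightarrow> T ` F i =\<^sub>m F (i + 1)) \<and>
        T ` F (d - 1) =\<^sub>m F 0))"
proof (rule exI[of _ "component ` K"], intro conjI)
  show "countable (component ` K)" by simp
  show "\<forall>E\<in>component ` K. ergodic_component T E" using component_ergodic by blast
  show "\<forall>E\<in>component ` K. \<forall>E'\<in>component ` K. E \<noteq> E' \<longrightarrow> E \<inter> E' =\<^sub>m {}"
    using component_disjoint by blast
  show "X =\<^sub>m \<Union>(component ` K)" by (rule X_eq_components)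
  show "\<forall>E\<in>component ` K. \<exists>d::nat.
      period a T ` {j. markov_interval a j \<subseteq>\<^sub>m E} = {d} \<and> 0 < d \<and>
      (\<exists>F :: nat \<Rightarrow> real set.
        (\<forall>i<d. exact_component (T ^^ d) (F i) \<and> F i \<in> markov_algebra a) \<and>
        (\<forall>i<d. \<forall>i'<d. i \<noteq> i' \<longrightarrow> F i \<inter> F i' =\<^sub>m {}) \<and>
        E =\<^sub>m (\<Union>i<d. F i) \<and>
        (\<forall>i. i + 1 < d \<longrightarrow> T ` F i =\<^sub>m F (i + 1)) \<and>
        T ` F (d - 1) =\<^sub>m F 0)"
  proof
    fix E assume "E \<in> component ` K"
    then obtain k where k: "k \<in> K" and E: "E = component k" by blast
    let ?F = "\<lambda>i. cells (cyclic_class k i)"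
    \<comment> \<open>The period is positive, so the successor of \<open>per k - 1\<close> is
      \<open>per k\<close>, which is congruent to \<open>0\<close>.\<close>
    have "cyclic_class k (Suc (per k - 1)) = cyclic_class k 0"
      using per_pos[OF k] by (intro cyclic_class_cong) (simp add: cong_def)
    then have last: "T ` ?F (per k - 1) =\<^sub>m ?F 0"
      using cyclic_class_image[OF k, of "per k - 1"] by simp
    have un: "component k =\<^sub>m (\<Union>i<per k. ?F i)"
      using component_cyclic_decomposition[OF k] by (simp add: eq_mod_def)
    show "\<exists>d::nat.
      period a T ` {j. markov_interval a j \<subseteq>\<^sub>m E} = {d} \<and> 0 < d \<and>
      (\<exists>F :: nat \<Rightarrow> real set.
        (\<forall>i<d. exact_component (T ^^ d) (F i) \<and> F i \<in> markov_algebra a) \<and>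
        (\<forall>i<d. \<forall>i'<d. i \<noteq> i' \<longrightarrow> F i \<inter> F i' =\<^sub>m {}) \<and>
        E =\<^sub>m (\<Union>i<d. F i) \<and>
        (\<forall>i. i + 1 < d \<longrightarrow> T ` F i =\<^sub>m F (i + 1)) \<and>
        T ` F (d - 1) =\<^sub>m F 0)"
      unfolding E
      using component_periods[OF k] per_pos[OF k] cyclic_class_exact[OF k] cells_markov_algebra
        cyclic_classes_disjoint[OF k] un cyclic_class_image[OF k] last
      by (intro exI[of _ "per k"] conjI exI[of _ ?F]) auto
  qed
qed

end

context surjective_markov_map
begin

section \<open>The conservative-invariant part as a conservative region\<close>

lemma dissipative_part_properties:
  shows dissipative_part_borel: "dissipative_part T \<in> sets borel"
    and wandering_subset_dissipative_part: "wandering T W \<Longrightarrow> W \<subseteq>\<^sub>m dissipative_part T"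
proof -
  have "is_measurable_union {W. wandering T W} (dissipative_part T)"
    unfolding dissipative_part_def
    by (rule is_measurable_union_measurable_union) (auto simp: wandering_def)
  then show "dissipative_part T \<in> sets borel" "wandering T W \<Longrightarrow> W \<subseteq>\<^sub>m dissipative_part T"
    by (auto simp: is_measurable_union_def)
qed

lemma invariant_hull_borel: "A \<in> sets borel \<Longrightarrow> invariant_hull T A \<in> sets borel"
  unfolding invariant_hull_def
  by (intro sets.countable_UN'' Tn_vimage_borel Tn_image_borel) auto

text \<open>Passing from \<open>T x\<close> to \<open>x\<close> raises \<open>k\<close> by one,
  passing from \<open>x\<close> to \<open>T x\<close> raises \<open>n\<close> by one; the hull
  admits both shifts, so invariance is exact.\<close>

lemma invariant_hull_invariant: "T x \<in> invariant_hull T A \<longleftrightarrow> x \<in> invariant_hull T A"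
proof
  assume "T x \<in> invariant_hull T A"
  then obtain k n where "k \<ge> 1" "(T ^^ k) (T x) \<in> (T ^^ n) ` A" by (auto simp: invariant_hull_def)
  then have "(T ^^ Suc k) x \<in> (T ^^ n) ` A" by (simp add: funpow_Suc_right del: funpow.simps)
  then show "x \<in> invariant_hull T A" unfolding invariant_hull_def by (intro UN_I[of "Suc k"] UN_I[of n]) auto
next
  assume "x \<in> invariant_hull T A"
  then obtain k n y where y: "k \<ge> 1" "(T ^^ k) x = (T ^^ n) y" "y \<in> A" by (auto simp: invariant_hull_def)
  have "(T ^^ k) (T x) = (T ^^ Suc n) y"
    using y(2) by (simp add: funpow_swap1[symmetric])
  then show "T x \<in> invariant_hull T A"
    using y unfolding invariant_hull_def by (intro UN_I[of k] UN_I[of "Suc n"]) auto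
qed

lemma subset_invariant_hull: "A \<subseteq> invariant_hull T A"
proof
  fix x assume "x \<in> A"
  then have "(T ^^ 1) x \<in> (T ^^ 1) ` A" by blast
  then show "x \<in> invariant_hull T A" unfolding invariant_hull_def by (intro UN_I[of 1] UN_I[of 1]) auto
qed

text \<open>\<open>I_C T\<close> is the hull of the conservative part minus the hull of the
  dissipative part. It is thus disjoint from the dissipative part, which contains every wandering
  set modulo null sets.\<close>

lemma conservative_region_I_C: "conservative_region a T \<tau> \<tau>' \<tau>'' k\<^sub>1 k\<^sub>2 \<theta> c \<eta> (I_C T)"
proof
  have I_C: "I_C T = invariant_hull T (conservative_part T) - invariant_hull T (dissipative_part T)"
    by (auto simp: I_C_def I_CD_def)
  show "I_C T \<in> sets borel"
    unfolding I_C conservative_part_def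
    by (intro sets.Diff invariant_hull_borel borel_comp dissipative_part_borel)
  show "T x \<in> I_C T \<longleftrightarrow> x \<in> I_C T" for x
    by (simp add: I_C invariant_hull_invariant)
  fix W assume W: "wandering T W" "W \<subseteq> I_C T"
  have "W \<inter> dissipative_part T = {}"
    using W(2) subset_invariant_hull unfolding I_C by blast
  with wandering_subset_dissipative_part[OF W(1)] show "negligible W"
    unfolding subset_mod_def negligible_iff_AE by (auto elim!: eventually_mono)
qed

end

theorem theorem2p3:
  fixes a :: "int \<Rightarrow> real" and T :: "real \<Rightarrow> real"
    and \<tau> \<tau>' \<tau>'' :: "int \<Rightarrow> real \<Rightarrow> real"
    and k\<^sub>1 k\<^sub>2 :: "int \<Rightarrow> int" and \<theta> c \<eta> :: real
  assumes "surjective_markov_map a T \<tau> \<tau>' \<tau>'' k\<^sub>1 k\<^sub>2 \<theta> c \<eta>"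
  shows "\<exists>\<E>. countable \<E> \<and>
    (\<forall>E\<in>\<E>. ergodic_component T E) \<and>
    (\<forall>E\<in>\<E>. \<forall>E'\<in>\<E>. E \<noteq> E' \<longrightarrow> E \<inter> E' =\<^sub>m {}) \<and>
    I_C T =\<^sub>m \<Union>\<E> \<and>
    (\<forall>E\<in>\<E>. \<exists>d::nat.
      period a T ` {j. markov_interval a j \<subseteq>\<^sub>m E} = {d} \<and> 0 < d \<and>
      (\<exists>F :: nat \<Rightarrow> real set.
        (\<forall>i<d. exact_component (T ^^ d) (F i) \<and> F i \<in> markov_algebra a) \<and>
        (\<forall>i<d. \<forall>i'<d. i \<noteq> i' \<longrightarrow> F i \<inter> F i' =\<^sub>m {}) \<and>
        E =\<^sub>m (\<Union>i<d. F i) \<and>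
        (\<forall>i. i + 1 < d \<longrightarrow> T ` F i =\<^sub>m F (i + 1)) \<and>
        T ` F (d - 1) =\<^sub>m F 0))"
  by (rule conservative_region.spectral_decomposition)
    (rule surjective_markov_map.conservative_region_I_C[OF assms])

end
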